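(* Let $\alpha,\kappa>0$, let $p,r\in\mathcal{P}(\mathbb{R}^n)$ and $1\le\nu\le p^-$. Then there is a constant $C>0$ such that for every $t>0$ and every $\varphi\in L^{r(\cdot)}(\mathbb{R}^n)\cap L^\nu(\mathbb{R}^n)$: (1) $\displaystyle\|g_{\alpha,t}*\varphi\|_{L^{p(\cdot)}(\mathbb{R}^n)}\le C\,t^{-\frac{n\omega(t)}{2\alpha}}\|\varphi\|_{L^{r(\cdot)}(\mathbb{R}^n)\cap L^\nu(\mathbb{R}^n)}$; (2) $\displaystyle\|(-\Delta)^{\kappa/2}g_{\alpha,t}*\varphi\|_{L^{p(\cdot)}(\mathbb{R}^n)}\le C\,t^{-\frac{\kappa}{2\alpha}-\frac{n\omega(t)}{2\alpha}}\|\varphi\|_{L^{r(\cdot)}(\mathbb{R}^n)\cap L^\nu(\mathbb{R}^n)}$; where $$\omega(t)=\begin{cases}\frac1{r^-}\left(1-\frac{\nu}{p^+}\right), & 0<t\le1,\\ \frac1{r^+}\left(1-\frac{\nu}{p^-}\right), & t>1.\end{cases}$$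
   Context: $g_{\alpha,t}=\mathcal{F}^{-1}[e^{-t|\xi|^{2\alpha}}]$ is the fractional heat kernel on $\mathbb{R}^n$, so that $g_{\alpha,t}*\varphi=e^{-t(-\Delta)^\alpha}\varphi$ (the multiplicative normalisation of the Fourier transform only affects constants); $(-\Delta)^{\kappa/2}$ is the Fourier multiplier with symbol $|\xi|^\kappa$. $\mathcal{P}(\mathbb{R}^n)$ is the set of measurable functions $p:\mathbb{R}^n\to[1,\infty]$; $p^-$ and $p^+$ are the essential infimum and supremum of $p$; $\frac{a}{\infty}:=0$ for $a\in[1,\infty]$. The modular is $\varrho_{p(\cdot)}(f)=\int_{\mathbb{R}^n}\omega_{p(x)}(|f(x)|)\,dx$, with $\omega_p(t)=t^p$ if $p<\infty$, and $\omega_\infty(t)=0$ for $t\le1$, $\omega_\infty(t)=\infty$ for $t>1$ (unrelated to the function $\omega(t)$ of the claim). $L^{p(\cdot)}(\mathbb{R}^n)$ is the space of measurable $f$ with $\varrho_{p(\cdot)}(\lambda f)<\infty$ for some $\lambda>0$, normed by $\|f\|_{L^{p(\cdot)}}=\inf\{\lambda>0:\varrho_{p(\cdot)}(f/\lambda)\le1\}$. An intersection $X\cap Y$ carries the norm $\max\{\|f\|_X,\|f\|_Y\}$. *)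

theory Defs
  imports "HOL-Analysis.Analysis" "HOL-Probability.Essential_Supremum"
begin

section \<open>Variable exponent Lebesgue spaces\<close>

definition essinf :: "'a measure \<Rightarrow> ('a \<Rightarrow> ennreal) \<Rightarrow> ennreal" where
  "essinf M f = Sup {z. AE x in M. z \<le> f x}"

text \<open>Exponents have values in \<open>[1,\<infinity>]\<close> and are represented in \<^typ>\<open>ennreal\<close>, where
  \<open>a / \<infinity> = 0\<close> for all \<open>a\<close>, including \<open>a = \<infinity>\<close>. Measurability is Lebesgue measurability
  throughout.\<close>

definition exponents :: "('a::euclidean_space \<Rightarrow> ennreal) set" where
  "exponents = {p \<in> borel_measurable lebesgue. \<forall>x. 1 \<le> p x}"

definition omega_mod :: "ennreal \<Rightarrow> real \<Rightarrow> ennreal" where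
  "omega_mod q s =
     (if q = \<infinity> then (if s \<le> 1 then 0 else \<infinity>) else ennreal (s powr enn2real q))"

definition modular :: "('a::euclidean_space \<Rightarrow> ennreal) \<Rightarrow> ('a \<Rightarrow> complex) \<Rightarrow> ennreal" where
  "modular p f = (\<integral>\<^sup>+ x. omega_mod (p x) (cmod (f x)) \<partial>lebesgue)"

definition Lvar :: "('a::euclidean_space \<Rightarrow> ennreal) \<Rightarrow> ('a \<Rightarrow> complex) set" where
  "Lvar p = {f \<in> borel_measurable lebesgue. \<exists>c>0. modular p (\<lambda>x. complex_of_real c * f x) < \<infinity>}"

text \<open>The infimum is taken in \<^typ>\<open>real\<close>, so this is the Luxemburg norm on \<^const>\<open>Lvar\<close> only
  (outside that space the set can be empty).\<close>

definition Lvar_norm :: "('a::euclidean_space \<Rightarrow> ennreal) \<Rightarrow> ('a \<Rightarrow> complex) \<Rightarrow> real" where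
  "Lvar_norm p f = Inf {c. c > 0 \<and> modular p (\<lambda>x. f x / complex_of_real c) \<le> 1}"

text \<open>The classical spaces \<open>L\<^sup>\<nu>\<close> are those with constant exponent.\<close>

abbreviation Lconst :: "ennreal \<Rightarrow> ('a::euclidean_space \<Rightarrow> complex) set" where
  "Lconst \<nu> \<equiv> Lvar (\<lambda>_. \<nu>)"

abbreviation Lconst_norm :: "ennreal \<Rightarrow> ('a::euclidean_space \<Rightarrow> complex) \<Rightarrow> real" where
  "Lconst_norm \<nu> \<equiv> Lvar_norm (\<lambda>_. \<nu>)"

lemma modular_scale_const:
  assumes "1 \<le> q" "c > 0" "f \<in> borel_measurable lebesgue"
  shows "modular (\<lambda>_. ennreal q) (\<lambda>x. complex_of_real c * f x)
       = ennreal (c powr q) * (\<integral>\<^sup>+ x. ennreal (cmod (f x) powr q) \<partial>lebesgue)"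
proof -
  have "modular (\<lambda>_. ennreal q) (\<lambda>x. complex_of_real c * f x)
      = (\<integral>\<^sup>+ x. ennreal (c powr q) * ennreal (cmod (f x) powr q) \<partial>lebesgue)"
    using assms unfolding modular_def omega_mod_def
    by (intro nn_integral_cong) (simp add: norm_mult powr_mult ennreal_mult)
  also have "\<dots> = ennreal (c powr q) * (\<integral>\<^sup>+ x. ennreal (cmod (f x) powr q) \<partial>lebesgue)"
    using assms(3) by (intro nn_integral_cmult) measurable
  finally show ?thesis .
qed

lemma Lconst_iff:
  assumes "1 \<le> q"
  shows "f \<in> Lconst (ennreal q) \<longleftrightarrow>
    f \<in> borel_measurable lebesgue \<and> (\<integral>\<^sup>+ x. ennreal (cmod (f x) powr q) \<partial>lebesgue) < \<infinity>"
    (is "_ \<longleftrightarrow> _ \<and> ?I < \<infinity>")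
proof (cases "f \<in> borel_measurable lebesgue")
  case True
  have "(\<exists>c>0. ennreal (c powr q) * ?I < \<infinity>) \<longleftrightarrow> ?I < \<infinity>"
    by (auto simp: ennreal_mult_less_top intro!: exI[of _ "1::real"])
  then show ?thesis
    using True by (auto simp: Lvar_def modular_scale_const[OF assms _ True])
qed (simp add: Lvar_def)

lemma Lconst_norm_eq:
  assumes q: "1 \<le> q" and f: "f \<in> Lconst (ennreal q)"
  shows "Lconst_norm (ennreal q) f
       = enn2real (\<integral>\<^sup>+ x. ennreal (cmod (f x) powr q) \<partial>lebesgue) powr (1 / q)"
proof -
  define I where "I = enn2real (\<integral>\<^sup>+ x. ennreal (cmod (f x) powr q) \<partial>lebesgue)"
  have meas: "f \<in> borel_measurable lebesgue"
    and I: "(\<integral>\<^sup>+ x. ennreal (cmod (f x) powr q) \<partial>lebesgue) = ennreal I"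
    using f by (auto simp: Lconst_iff[OF q] I_def)
  have [simp]: "I \<ge> 0" by (simp add: I_def)
  have *: "modular (\<lambda>_. ennreal q) (\<lambda>x. f x / complex_of_real c) \<le> 1 \<longleftrightarrow> I powr (1 / q) \<le> c"
    if "c > 0" for c
  proof -
    have "modular (\<lambda>_. ennreal q) (\<lambda>x. f x / complex_of_real c)
        = ennreal ((1 / c) powr q) * ennreal I"
      using modular_scale_const[OF q, of "1 / c" f] that meas I by simp
    also have "\<dots> = ennreal (I / c powr q)"
      using that by (simp add: powr_divide flip: ennreal_mult)
    finally have "modular (\<lambda>_. ennreal q) (\<lambda>x. f x / complex_of_real c) \<le> 1 \<longleftrightarrow> I \<le> c powr q"
      using that by simp
    also have "\<dots> \<longleftrightarrow> I powr (1 / q) \<le> c"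
    proof
      assume "I \<le> c powr q"
      then have "I powr (1 / q) \<le> (c powr q) powr (1 / q)"
        using q by (intro powr_mono2) auto
      then show "I powr (1 / q) \<le> c" using that q by (simp add: powr_powr)
    next
      assume "I powr (1 / q) \<le> c"
      then have "(I powr (1 / q)) powr q \<le> c powr q"
        using q by (intro powr_mono2) auto
      then show "I \<le> c powr q" using q by (simp add: powr_powr)
    qed
    finally show ?thesis .
  qed
  have "Lconst_norm (ennreal q) f = Inf {c. c > 0 \<and> I powr (1 / q) \<le> c}"
    unfolding Lvar_norm_def using * by (metis (no_types, lifting))
  also have "\<dots> = I powr (1 / q)"
  proof (cases "I = 0")
    case True
    then have "{c. c > 0 \<and> I powr (1 / q) \<le> c} = {0<..}" by auto
    then show ?thesis using True by simp
  next
    case False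
    then have "I powr (1 / q) > 0" by simp
    then have "{c. c > 0 \<and> I powr (1 / q) \<le> c} = {I powr (1 / q)..}"
      by (auto intro: less_le_trans simp del: powr_gt_zero)
    then show ?thesis by simp
  qed
  finally show ?thesis by (simp add: I_def)
qed

lemma Lconst_norm_infinity_eq:
  assumes "f \<in> borel_measurable lebesgue"
  shows "Lconst_norm \<infinity> f = Inf {c. c > 0 \<and> (AE x in lebesgue. cmod (f x) \<le> c)}"
proof -
  have "modular (\<lambda>_. \<infinity>) (\<lambda>x. f x / complex_of_real c) \<le> 1 \<longleftrightarrow> (AE x in lebesgue. cmod (f x) \<le> c)"
    if "c > 0" for c
  proof -
    let ?A = "{x. c < cmod (f x)}"
    have "{x \<in> space lebesgue. c < cmod (f x)} \<in> sets lebesgue"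
      using assms by measurable
    then have A: "?A \<in> sets lebesgue" by simp
    have "modular (\<lambda>_. \<infinity>) (\<lambda>x. f x / complex_of_real c) = (\<integral>\<^sup>+ x. \<infinity> * indicator ?A x \<partial>lebesgue)"
      unfolding modular_def omega_mod_def using that
      by (intro nn_integral_cong) (auto simp: norm_divide divide_simps split: split_indicator)
    also have "\<dots> = \<infinity> * emeasure lebesgue ?A"
      using A by (rule nn_integral_cmult_indicator)
    finally have "modular (\<lambda>_. \<infinity>) (\<lambda>x. f x / complex_of_real c) \<le> 1 \<longleftrightarrow> emeasure lebesgue ?A = 0"
      by (auto simp: ennreal_top_mult top_unique)
    also have "\<dots> \<longleftrightarrow> (AE x in lebesgue. cmod (f x) \<le> c)"
      by (subst AE_iff_measurable[OF A]) (auto simp: not_le)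
    finally show ?thesis .
  qed
  then show ?thesis
    unfolding Lvar_norm_def by (metis (no_types, lifting))
qed

section \<open>Fourier multipliers and the fractional heat kernel\<close>

text \<open>The Fourier transform is normalised so that it turns convolutions into products with no
  additional constant; thus convolution with the heat kernel is exactly the semigroup
  \<open>exp (-t (-\<Delta>)\<^sup>\<alpha>)\<close>. Both integrals are absolutely convergent (for integrable arguments).\<close>

definition fourier :: "('a::euclidean_space \<Rightarrow> complex) \<Rightarrow> 'a \<Rightarrow> complex" where
  "fourier f \<xi> = (LINT x|lebesgue. cis (- (x \<bullet> \<xi>)) * f x)"

definition inv_fourier :: "('a::euclidean_space \<Rightarrow> complex) \<Rightarrow> 'a \<Rightarrow> complex" where
  "inv_fourier h x =
     (LINT \<xi>|lebesgue. cis (x \<bullet> \<xi>) * h \<xi>) / complex_of_real ((2 * pi) ^ DIM('a))"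

definition fourier_multiplier ::
    "('a::euclidean_space \<Rightarrow> complex) \<Rightarrow> ('a \<Rightarrow> complex) \<Rightarrow> 'a \<Rightarrow> complex" where
  "fourier_multiplier m f = inv_fourier (\<lambda>\<xi>. m \<xi> * fourier f \<xi>)"

text \<open>\<open>frac_laplacian s\<close> is \<open>(-\<Delta>)\<^sup>s\<close>.\<close>

definition frac_laplacian ::
    "real \<Rightarrow> ('a::euclidean_space \<Rightarrow> complex) \<Rightarrow> 'a \<Rightarrow> complex" where
  "frac_laplacian s = fourier_multiplier (\<lambda>\<xi>. complex_of_real (norm \<xi> powr (2 * s)))"

definition heat_kernel :: "real \<Rightarrow> real \<Rightarrow> 'a::euclidean_space \<Rightarrow> complex" where
  "heat_kernel \<alpha> t = inv_fourier (\<lambda>\<xi>. complex_of_real (exp (- t * norm \<xi> powr (2 * \<alpha>))))"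

definition conv ::
    "('a::euclidean_space \<Rightarrow> complex) \<Rightarrow> ('a \<Rightarrow> complex) \<Rightarrow> 'a \<Rightarrow> complex" where
  "conv g f x = (LINT y|lebesgue. g (x - y) * f y)"

section \<open>The decay exponent\<close>

definition decay_omega ::
    "('a::euclidean_space \<Rightarrow> ennreal) \<Rightarrow> ('a \<Rightarrow> ennreal) \<Rightarrow> ennreal \<Rightarrow> real \<Rightarrow> real" where
  "decay_omega p r \<nu> t =
     (if t \<le> 1
      then enn2real (1 / essinf lebesgue r) * (1 - enn2real (\<nu> / esssup lebesgue p))
      else enn2real (1 / esssup lebesgue r) * (1 - enn2real (\<nu> / essinf lebesgue p)))"

end

theory Submission
  imports Defs "HOL-Probability.Characteristic_Functions" "HOL-Real_Asymp.Real_Asymp"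
begin

text \<open>
  Both kernels are inverse Fourier transforms of \<open>\<bar>\<xi>\<bar>\<^sup>\<kappa> exp (- t \<bar>\<xi>\<bar>\<^sup>2\<^sup>\<alpha>)\<close>, where \<open>\<kappa> = 0\<close> gives the heat
  kernel; Fourier inversion is needed to see this for the fractional Laplacian of the heat kernel.
  By scaling such a kernel is bounded by \<open>D N\<close> and has \<open>L\<^sup>1\<close> norm at most \<open>D\<close>, with
  \<open>N = t powr (- n / (2 \<alpha>))\<close> and \<open>D\<close> proportional to \<open>t powr (- \<kappa> / (2 \<alpha>))\<close>, provided that
  the kernel is integrable at \<open>t = 1\<close>. The symbol is in general not smooth at the origin; integrability
  follows by writing it as a superposition, of finite total mass, of dilated Bochner--Riesz means
  \<open>(1 - \<bar>\<xi>\<bar>\<^sup>2 / s)\<^sub>+\<^sup>M\<close> of high order, whose inverse transforms decay fast.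

  For \<open>\<phi>\<close> of norm at most 1 in \<open>L\<^sup>r\<close> and \<open>L\<^sup>\<nu>\<close>, splitting \<open>\<phi>\<close> at height \<open>B = N powr (1 / r\<^sup>\<plusminus>)\<close> bounds the
  convolution by \<open>2 D B\<close>, Young's inequality bounds its \<open>L\<^sup>\<nu>\<close> norm by \<open>D\<close>, and the estimate in
  \<open>L\<^sup>p\<close> follows by interpolation inside the modular.
\<close>

section \<open>Convolutions in variable exponent spaces\<close>

text \<open>Only two bounds that do not see the variation of the exponents are combined: a supremum
  bound, which \<open>r\<close> enters through its modular alone, and Young's inequality for the
  constant exponent. Since p is at least \<nu> almost everywhere, |f|^p is |f|^\<nu> times at most
  B^(p - \<nu>), and this factor is removed by dividing f by B^\<theta> with \<theta> = 1 -
  \<nu>/p^+ or 1 - \<nu>/p^-. The case distinction in \<omega>(t) is that between N >= 1 and N <= 1: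
  comparison of powers of N reverses, and with it the extremal values of p and r that serve almost
  every point.

  Bochner--Riesz means are good building blocks because 1 - |\<xi>|^2 is a polynomial: they are
  smooth at the origin, and their only singularity, on the unit sphere, is as mild as the order M is
  large. The roughness of the symbol at the origin is carried by the mass that the superposition
  puts on small s, and dilation costs nothing in L^1.\<close>

lemma nn_integral_lborel_affine:
  fixes f :: "'a::euclidean_space \<Rightarrow> ennreal"
  assumes [measurable]: "f \<in> borel_measurable borel" and c: "c \<noteq> 0"
  shows "(\<integral>\<^sup>+x. f x \<partial>lborel) = ennreal (\<bar>c\<bar> ^ DIM('a)) * (\<integral>\<^sup>+x. f (a + c *\<^sub>R x) \<partial>lborel)"
  by (subst lborel_affine[OF c, of a])
     (simp add: nn_integral_density nn_integral_distr nn_integral_cmult)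

lemma integrable_lborel_affine:
  fixes f :: "'a::euclidean_space \<Rightarrow> 'b::{banach, second_countable_topology}"
  assumes f: "integrable lborel f" and c: "c \<noteq> 0"
  shows "integrable lborel (\<lambda>x. f (a + c *\<^sub>R x))"
  using f f[THEN borel_measurable_integrable] c unfolding integrable_iff_bounded
  by (subst (asm) nn_integral_lborel_affine[where c=c and a=a]) (auto simp: ennreal_mult_less_top)

lemma integrable_lborel_affine_iff:
  fixes f :: "'a::euclidean_space \<Rightarrow> 'b::{banach, second_countable_topology}"
  assumes c: "c \<noteq> 0"
  shows "integrable lborel (\<lambda>x. f (a + c *\<^sub>R x)) \<longleftrightarrow> integrable lborel f"
proof
  assume "integrable lborel (\<lambda>x. f (a + c *\<^sub>R x))"
  from integrable_lborel_affine[OF this, of "1 / c" "- (1 / c) *\<^sub>R a"] c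
  show "integrable lborel f" by (simp add: algebra_simps)
qed (rule integrable_lborel_affine[OF _ c])

lemma integral_lborel_affine:
  fixes f :: "'a::euclidean_space \<Rightarrow> 'b::{banach, second_countable_topology}"
  assumes c: "c \<noteq> 0"
  shows "(\<integral>x. f x \<partial>lborel) = \<bar>c\<bar> ^ DIM('a) *\<^sub>R (\<integral>x. f (a + c *\<^sub>R x) \<partial>lborel)"
proof (cases "integrable lborel f")
  case True
  then show ?thesis
    using True[THEN borel_measurable_integrable] integrable_lborel_affine[OF True c, of a]
    by (subst lborel_affine[OF c, of a]) (simp add: integral_density integral_distr)
next
  case False
  then show ?thesis
    using integrable_lborel_affine_iff[OF c, of f a] by (simp add: not_integrable_integral_eq)
qed

lemma nn_integral_lborel_reflect:
  fixes f :: "'a::euclidean_space \<Rightarrow> ennreal"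
  assumes [measurable]: "f \<in> borel_measurable borel"
  shows "(\<integral>\<^sup>+y. f (x - y) \<partial>lborel) = (\<integral>\<^sup>+y. f y \<partial>lborel)"
  using nn_integral_lborel_affine[of f "-1" x] by simp

text \<open>For a non-integrable \<open>f\<close> the Bochner integral is 0 by convention, so the
  bound is available before integrability of a convolution integrand is known.\<close>

lemma ennreal_norm_integral_le:
  fixes f :: "_ \<Rightarrow> 'b::{banach, second_countable_topology}"
  shows "ennreal (norm (integral\<^sup>L M f)) \<le> (\<integral>\<^sup>+x. ennreal (norm (f x)) \<partial>M)"
  using integral_norm_bound_ennreal[of M f]
  by (cases "integrable M f") (auto simp: not_integrable_integral_eq)

lemma lebesgue_ex_borel_complex:
  fixes f :: "'a::euclidean_space \<Rightarrow> complex"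
  assumes "f \<in> borel_measurable lebesgue"
  obtains g where "g \<in> borel_measurable borel" "AE x in lborel. f x = g x"
proof -
  have "(\<lambda>x. Re (f x)) \<in> borel_measurable lebesgue" "(\<lambda>x. Im (f x)) \<in> borel_measurable lebesgue"
    using assms by measurable
  then obtain u v where u: "u \<in> borel_measurable lborel" "AE x in lborel. Re (f x) = u x"
    and v: "v \<in> borel_measurable lborel" "AE x in lborel. Im (f x) = v x"
    using completion_ex_borel_measurable_real by metis
  have "(\<lambda>x. Complex (u x) (v x)) \<in> borel_measurable borel"
    using u(1) v(1) by (simp add: borel_measurable_complex_iff)
  moreover have "AE x in lborel. f x = Complex (u x) (v x)"
    using u(2) v(2) by eventually_elim (simp add: complex_eq_iff)
  ultimately show thesis using that by blast
qed

section \<open>Convolution with a fixed kernel: supremum bound and Young's inequality\<close>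

context
  fixes k \<phi> :: "'a::euclidean_space \<Rightarrow> complex"
  assumes k [measurable]: "k \<in> borel_measurable borel"
    and \<phi> [measurable]: "\<phi> \<in> borel_measurable lebesgue"
begin

text \<open>Measurability in \<open>x\<close> and Tonelli require an integrand measurable on the
  product space, which a merely Lebesgue measurable \<open>\<phi>\<close> does not give directly. A
  Borel representative changes the integrand on a null set of \<open>y\<close> for each fixed
  \<open>x\<close>, so the convolution is the same at every point.\<close>

lemma conv_borel_version:
  obtains \<psi> where "\<psi> \<in> borel_measurable borel" "AE x in lborel. \<phi> x = \<psi> x"
    "conv k \<phi> = (\<lambda>x. LINT y|lborel. k (x - y) * \<psi> y)"
proof -
  obtain \<psi> where \<psi> [measurable]: "\<psi> \<in> borel_measurable borel" and AE: "AE x in lborel. \<phi> x = \<psi> x"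
    using \<phi> by (rule lebesgue_ex_borel_complex)
  have "conv k \<phi> x = (LINT y|lborel. k (x - y) * \<psi> y)" for x
  proof -
    have k': "(\<lambda>y. k (x - y)) \<in> borel_measurable lebesgue"
      by (intro measurable_completion) measurable
    have "conv k \<phi> x = (LINT y|lebesgue. k (x - y) * \<psi> y)"
      unfolding conv_def
    proof (rule integral_cong_AE)
      show "(\<lambda>y. k (x - y) * \<phi> y) \<in> borel_measurable lebesgue" using k' \<phi> by measurable
      show "(\<lambda>y. k (x - y) * \<psi> y) \<in> borel_measurable lebesgue"
        by (intro measurable_completion) measurable
      show "AE y in lebesgue. k (x - y) * \<phi> y = k (x - y) * \<psi> y"
        using AE_completion[OF AE] by eventually_elim simp
    qed
    also have "\<dots> = (LINT y|lborel. k (x - y) * \<psi> y)"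
      by (rule integral_completion) measurable
    finally show ?thesis .
  qed
  then show thesis using that[OF \<psi> AE] by auto
qed

lemma borel_measurable_conv: "conv k \<phi> \<in> borel_measurable borel"
proof -
  obtain \<psi> where [measurable]: "\<psi> \<in> borel_measurable borel"
    and eq: "conv k \<phi> = (\<lambda>x. LINT y|lborel. k (x - y) * \<psi> y)"
    by (rule conv_borel_version)
  have "(\<lambda>x. LINT y|lborel. k (x - y) * \<psi> y) \<in> borel_measurable borel"
    by (rule lborel.borel_measurable_lebesgue_integral) measurable
  then show ?thesis unfolding eq .
qed

lemma cmod_conv_le:
  "ennreal (cmod (conv k \<phi> x)) \<le> (\<integral>\<^sup>+y. ennreal (cmod (k (x - y))) * ennreal (cmod (\<phi> y)) \<partial>lebesgue)"
  using ennreal_norm_integral_le[of lebesgue "\<lambda>y. k (x - y) * \<phi> y"]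
  by (simp add: conv_def norm_mult ennreal_mult)

lemma nn_integral_cmod_reflect:
  "(\<integral>\<^sup>+y. ennreal (cmod (k (x - y))) \<partial>lebesgue) = (\<integral>\<^sup>+y. ennreal (cmod (k y)) \<partial>lborel)"
  using nn_integral_lborel_reflect[of "\<lambda>y. ennreal (cmod (k y))" x] by (simp add: nn_integral_completion)

lemma borel_measurable_lebesgue_reflect: "(\<lambda>y. k (x - y)) \<in> borel_measurable lebesgue"
  by (intro measurable_completion) measurable

text \<open>Splitting \<open>\<phi>\<close> at height \<open>B = N\<^sup>\<rho>\<close>: the part below \<open>B\<close> is bounded, and where \<open>\<bar>\<phi>\<bar>\<close>
  exceeds \<open>B\<close> it is dominated by \<open>B / N\<close> times the integrand of the modular.\<close>

lemma cmod_conv_le_modular: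
  assumes r: "r \<in> exponents" and mod: "modular r \<phi> \<le> 1"
    and D: "D > 0" and N: "N > 0"
    and kN: "\<And>x. cmod (k x) \<le> D * N"
    and kD: "(\<integral>\<^sup>+x. ennreal (cmod (k x)) \<partial>lborel) \<le> ennreal D"
    and AE_inf: "AE y in lebesgue. r y = \<infinity> \<longrightarrow> 1 \<le> N powr \<rho>"
    and AE_fin: "AE y in lebesgue. r y < \<infinity> \<longrightarrow> N \<le> N powr (\<rho> * enn2real (r y))"
  shows "cmod (conv k \<phi> x) \<le> 2 * D * N powr \<rho>"
proof -
  define B where "B = N powr \<rho>"
  have B: "B > 0" using N by (simp add: B_def)
  have [measurable]: "r \<in> borel_measurable lebesgue" and r1: "1 \<le> r y" for y
    using r by (auto simp: exponents_def)
  note [measurable] = borel_measurable_lebesgue_reflect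
  define W where "W y = omega_mod (r y) (cmod (\<phi> y))" for y
  have W [measurable]: "W \<in> borel_measurable lebesgue"
    unfolding W_def omega_mod_def by measurable
  have W1: "(\<integral>\<^sup>+y. W y \<partial>lebesgue) \<le> 1" using mod by (simp add: modular_def W_def)
  then have "AE y in lebesgue. W y \<noteq> \<infinity>"
    by (intro nn_integral_PInf_AE) (auto simp: top_unique)
  then have "AE y in lebesgue. ennreal (cmod (k (x - y))) * ennreal (cmod (\<phi> y))
      \<le> ennreal B * ennreal (cmod (k (x - y))) + ennreal (D * B) * W y"
    using AE_inf AE_fin
  proof eventually_elim
    case (elim y)
    show ?case
    proof (cases "cmod (\<phi> y) \<le> B")
      case True
      then have "ennreal (cmod (k (x - y))) * ennreal (cmod (\<phi> y)) \<le> ennreal (cmod (k (x - y))) * ennreal B"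
        by (intro mult_left_mono ennreal_leI) auto
      then show ?thesis by (simp add: add_increasing2 mult.commute)
    next
      case False
      \<comment> \<open>Where the exponent is infinite, finiteness of \<open>W\<close> forces
        |\<phi>| <= 1 <= B; hence every point above height B has a finite exponent.\<close>
      have fin: "r y < \<infinity>"
      proof (rule ccontr)
        assume "\<not> r y < \<infinity>"
        then have *: "r y = \<infinity>" by (simp add: not_less top_unique)
        then have "1 \<le> B" using elim B_def by simp
        moreover have "cmod (\<phi> y) \<le> 1"
          using elim * by (auto simp: W_def omega_mod_def split: if_splits)
        ultimately show False using False by simp
      qed
      define q where "q = enn2real (r y)"
      have q: "q \<ge> 1"
        using r1[of y] fin unfolding q_def by (cases "r y") auto
      have Bq: "N \<le> B powr q"
        using elim fin by (simp add: B_def q_def powr_powr)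
      have W_eq: "W y = ennreal (cmod (\<phi> y) powr q)"
        using fin by (simp add: W_def omega_mod_def q_def)
      have "cmod (k (x - y)) * cmod (\<phi> y) \<le> D * N * cmod (\<phi> y)"
        by (intro mult_right_mono kN) auto
      also have "\<dots> \<le> D * B powr q * cmod (\<phi> y)"
        using Bq D by (intro mult_right_mono mult_left_mono) auto
      also have "\<dots> = D * B * (B powr (q - 1) * cmod (\<phi> y))"
        using B by (simp add: powr_diff)
      also have "\<dots> \<le> D * B * (cmod (\<phi> y) powr (q - 1) * cmod (\<phi> y))"
        using D B q False by (intro mult_left_mono mult_right_mono powr_mono2) auto
      also have "\<dots> = D * B * cmod (\<phi> y) powr q"
        using B False by (simp add: powr_diff)
      finally have "ennreal (cmod (k (x - y))) * ennreal (cmod (\<phi> y)) \<le> ennreal (D * B) * W y"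
        using D B by (simp add: W_eq ennreal_leI flip: ennreal_mult)
      then show ?thesis by (simp add: add_increasing)
    qed
  qed
  then have "(\<integral>\<^sup>+y. ennreal (cmod (k (x - y))) * ennreal (cmod (\<phi> y)) \<partial>lebesgue)
      \<le> (\<integral>\<^sup>+y. ennreal B * ennreal (cmod (k (x - y))) + ennreal (D * B) * W y \<partial>lebesgue)"
    by (rule nn_integral_mono_AE)
  also have "\<dots> = ennreal B * (\<integral>\<^sup>+y. ennreal (cmod (k (x - y))) \<partial>lebesgue)
      + ennreal (D * B) * (\<integral>\<^sup>+y. W y \<partial>lebesgue)"
    by (subst nn_integral_add, measurable, subst (1 2) nn_integral_cmult) auto
  also have "\<dots> \<le> ennreal B * ennreal D + ennreal (D * B) * 1"
    using kD W1 by (intro add_mono mult_left_mono) (auto simp: nn_integral_cmod_reflect)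
  also have "\<dots> = ennreal (2 * D * B)"
    using D B by (simp flip: ennreal_mult ennreal_plus)
  finally have "ennreal (cmod (conv k \<phi> x)) \<le> ennreal (2 * D * B)"
    using cmod_conv_le order_trans by blast
  then show ?thesis using D B by (simp add: B_def)
qed

text \<open>Jensen's inequality for the measure |k(x - y)| dy gives |conv k \<phi>|^q <= D^(q-1) J
  with J the convolution of |k| and |\<phi>|^q; Tonelli then bounds the integral of J. Jensen is
  obtained by integrating the pointwise Young inequality with a free parameter c.\<close>

lemma young_conv:
  assumes q: "1 \<le> q" and D: "D > 0"
    and kD: "(\<integral>\<^sup>+x. ennreal (cmod (k x)) \<partial>lborel) \<le> ennreal D"
  shows "(\<integral>\<^sup>+x. ennreal (cmod (conv k \<phi> x) powr q) \<partial>lebesgue)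
    \<le> ennreal (D powr q) * (\<integral>\<^sup>+x. ennreal (cmod (\<phi> x) powr q) \<partial>lebesgue)"
proof -
  obtain \<psi> where [measurable]: "\<psi> \<in> borel_measurable borel"
    and AE: "AE x in lborel. \<phi> x = \<psi> x" and eq: "conv k \<phi> = (\<lambda>x. LINT y|lborel. k (x - y) * \<psi> y)"
    by (rule conv_borel_version)
  define J where "J x = (\<integral>\<^sup>+y. ennreal (cmod (k (x - y))) * ennreal (cmod (\<psi> y) powr q) \<partial>lborel)" for x
  have le_J: "ennreal (cmod (conv k \<phi> x) powr q) \<le> ennreal (D powr (q - 1)) * J x" for x
  proof -
    define F where "F = cmod (conv k \<phi> x)"
    have F: "ennreal F \<le> (\<integral>\<^sup>+y. ennreal (cmod (k (x - y))) * ennreal (cmod (\<psi> y)) \<partial>lborel)"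
      using ennreal_norm_integral_le[of lborel "\<lambda>y. k (x - y) * \<psi> y"]
      by (simp add: F_def eq norm_mult ennreal_mult)
    have F0: "F \<ge> 0" by (simp add: F_def)
    \<comment> \<open>This is the bound D-average of |\<psi>|, the optimal parameter: it turns q
      c^(q-1) F into q c^q D, so that the remainder (q-1) c^q D can be subtracted.\<close>
    define c where "c = F / D"
    have c: "c \<ge> 0" using D by (simp add: c_def F_def)
    have young: "q * (s * c powr (q - 1)) \<le> s powr q + (q - 1) * c powr q" if "s \<ge> 0" for s
    \<comment> \<open>For q = 1 the conjugate exponent q/(q-1) degenerates, and c = 0 is separate
      because \<open>0 powr 0 = 0\<close>.\<close>
    proof (cases "q = 1")
      case True
      then show ?thesis using that c by (cases "c = 0") auto
    next
      case False
      then have q1: "q > 1" using q by simp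
      have "s * c powr (q - 1) \<le> s powr q / q + (c powr (q - 1)) powr (q / (q - 1)) / (q / (q - 1))"
        by (rule Youngs_inequality) (use q1 that in \<open>auto simp: field_simps\<close>)
      also have "(c powr (q - 1)) powr (q / (q - 1)) = c powr q"
        using q1 by (simp add: powr_powr)
      finally show ?thesis using q1 by (simp add: field_simps)
    qed
    have "(\<integral>\<^sup>+y. ennreal (q * c powr (q - 1)) * (ennreal (cmod (k (x - y))) * ennreal (cmod (\<psi> y))) \<partial>lborel)
      \<le> (\<integral>\<^sup>+y. ennreal (cmod (k (x - y))) * ennreal (cmod (\<psi> y) powr q)
            + ennreal ((q - 1) * c powr q) * ennreal (cmod (k (x - y))) \<partial>lborel)"
    proof (rule nn_integral_mono)
      fix y
      have "cmod (k (x - y)) * (q * (cmod (\<psi> y) * c powr (q - 1)))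
          \<le> cmod (k (x - y)) * (cmod (\<psi> y) powr q + (q - 1) * c powr q)"
        by (intro mult_left_mono young) auto
      then show "ennreal (q * c powr (q - 1)) * (ennreal (cmod (k (x - y))) * ennreal (cmod (\<psi> y)))
        \<le> ennreal (cmod (k (x - y))) * ennreal (cmod (\<psi> y) powr q)
            + ennreal ((q - 1) * c powr q) * ennreal (cmod (k (x - y)))"
        using q by (auto simp: ennreal_mult'[symmetric] ennreal_plus[symmetric] mult_ac distrib_left
            simp del: ennreal_plus intro!: ennreal_leI)
    qed
    also have "\<dots> = J x + ennreal ((q - 1) * c powr q) * (\<integral>\<^sup>+y. ennreal (cmod (k (x - y))) \<partial>lborel)"
      by (subst nn_integral_add) (auto simp: J_def nn_integral_cmult)
    also have "\<dots> \<le> J x + ennreal ((q - 1) * c powr q) * ennreal D"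
      using kD nn_integral_cmod_reflect[of x]
      by (intro add_left_mono mult_left_mono) (auto simp: nn_integral_completion)
    finally have "ennreal (q * c powr (q - 1)) * ennreal F \<le> J x + ennreal ((q - 1) * c powr q) * ennreal D"
      using F by (subst (asm) nn_integral_cmult) (auto intro: order_trans[OF mult_left_mono])
    moreover have "q * c powr (q - 1) * F = q * c powr q * D"
      using D F0 by (cases "c = 0") (auto simp: c_def powr_diff field_simps)
    ultimately have "ennreal (q * c powr q * D) \<le> J x + ennreal ((q - 1) * c powr q * D)"
      using q D F0 by (simp only: ennreal_mult[symmetric] mult_nonneg_nonneg powr_ge_zero)
    moreover have "q * c powr q * D = c powr q * D + (q - 1) * c powr q * D"
      by (simp add: algebra_simps)
    ultimately have "ennreal (c powr q * D) + ennreal ((q - 1) * c powr q * D)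
        \<le> J x + ennreal ((q - 1) * c powr q * D)"
      using q D by (simp flip: ennreal_plus)
    \<comment> \<open>The cancelled summand is a finite real, so this is legitimate in
      \<open>ennreal\<close> even when \<open>J x\<close> is infinite.\<close>
    then have "ennreal (c powr q * D) \<le> J x"
      by (simp add: add.commute ennreal_add_left_cancel_le)
    then have "ennreal (D powr (q - 1)) * ennreal (c powr q * D) \<le> ennreal (D powr (q - 1)) * J x"
      by (rule mult_left_mono) simp
    also have "ennreal (D powr (q - 1)) * ennreal (c powr q * D) = ennreal (F powr q)"
      using D by (simp add: c_def powr_divide powr_diff F_def flip: ennreal_mult)
    finally show ?thesis by (simp add: F_def)
  qed
  have "(\<integral>\<^sup>+x. J x \<partial>lborel)
      = (\<integral>\<^sup>+y. \<integral>\<^sup>+x. ennreal (cmod (k (x - y))) * ennreal (cmod (\<psi> y) powr q) \<partial>lborel \<partial>lborel)"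
    unfolding J_def by (rule lborel_pair.Fubini') measurable
  also have "\<dots> = (\<integral>\<^sup>+y. (\<integral>\<^sup>+x. ennreal (cmod (k x)) \<partial>lborel) * ennreal (cmod (\<psi> y) powr q) \<partial>lborel)"
  proof (rule nn_integral_cong)
    fix y
    have "(\<integral>\<^sup>+x. ennreal (cmod (k (x - y))) \<partial>lborel) = (\<integral>\<^sup>+x. ennreal (cmod (k x)) \<partial>lborel)"
      using nn_integral_lborel_affine[of "\<lambda>x. ennreal (cmod (k x))" 1 "-y"] by simp
    then show "(\<integral>\<^sup>+x. ennreal (cmod (k (x - y))) * ennreal (cmod (\<psi> y) powr q) \<partial>lborel)
        = (\<integral>\<^sup>+x. ennreal (cmod (k x)) \<partial>lborel) * ennreal (cmod (\<psi> y) powr q)"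
      by (subst nn_integral_multc) auto
  qed
  also have "\<dots> \<le> (\<integral>\<^sup>+y. ennreal D * ennreal (cmod (\<psi> y) powr q) \<partial>lborel)"
    using kD by (intro nn_integral_mono mult_right_mono) auto
  also have "\<dots> = ennreal D * (\<integral>\<^sup>+y. ennreal (cmod (\<psi> y) powr q) \<partial>lborel)"
    by (rule nn_integral_cmult) measurable
  also have "(\<integral>\<^sup>+y. ennreal (cmod (\<psi> y) powr q) \<partial>lborel) = (\<integral>\<^sup>+y. ennreal (cmod (\<phi> y) powr q) \<partial>lborel)"
    by (rule nn_integral_cong_AE) (use AE in eventually_elim, simp)
  finally have J: "(\<integral>\<^sup>+x. J x \<partial>lborel) \<le> ennreal D * (\<integral>\<^sup>+x. ennreal (cmod (\<phi> x) powr q) \<partial>lborel)" .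
  have "(\<integral>\<^sup>+x. ennreal (cmod (conv k \<phi> x) powr q) \<partial>lborel) \<le> (\<integral>\<^sup>+x. ennreal (D powr (q - 1)) * J x \<partial>lborel)"
    by (intro nn_integral_mono le_J)
  also have "\<dots> = ennreal (D powr (q - 1)) * (\<integral>\<^sup>+x. J x \<partial>lborel)"
    unfolding J_def by (rule nn_integral_cmult) measurable
  also have "\<dots> \<le> ennreal (D powr (q - 1)) * (ennreal D * (\<integral>\<^sup>+x. ennreal (cmod (\<phi> x) powr q) \<partial>lborel))"
    by (rule mult_left_mono[OF J]) simp
  also have "\<dots> = ennreal (D powr q) * (\<integral>\<^sup>+x. ennreal (cmod (\<phi> x) powr q) \<partial>lborel)"
    using D by (simp add: powr_diff mult.assoc[symmetric] flip: ennreal_mult)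
  finally show ?thesis by (simp add: nn_integral_completion)
qed

end

text \<open>At finite p, write |f|^p = |f|^\<nu> |f|^(p-\<nu>) and bound the last factor by
  B^(p-\<nu>), which the divisor B^(\<theta> p) absorbs; at infinite p only the supremum bound is
  used.\<close>

lemma modular_interpolate:
  fixes p :: "'a::euclidean_space \<Rightarrow> ennreal"
  assumes B: "B > 0" and f_le: "\<And>x. cmod (f x) \<le> B"
    and modf: "\<nu> < \<infinity> \<Longrightarrow> modular (\<lambda>_. \<nu>) f \<le> 1"
    and AE_inf: "AE x in lebesgue. p x = \<infinity> \<longrightarrow> B \<le> B powr \<theta>"
    and AE_fin: "AE x in lebesgue. p x < \<infinity> \<longrightarrow>
      \<nu> < \<infinity> \<and> enn2real \<nu> \<le> enn2real (p x) \<and> B powr (enn2real (p x) - enn2real \<nu>) \<le> B powr (\<theta> * enn2real (p x))"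
  shows "modular p (\<lambda>x. f x / complex_of_real (B powr \<theta>)) \<le> 1"
proof -
  \<comment> \<open>If \<nu> is infinite, \<open>AE_fin\<close> makes p infinite almost everywhere,
    and there the integrand of the modular is 0; hence the majorant 0 in that case.\<close>
  have "modular p (\<lambda>x. f x / complex_of_real (B powr \<theta>))
      \<le> (\<integral>\<^sup>+x. (if \<nu> = \<infinity> then 0 else omega_mod \<nu> (cmod (f x))) \<partial>lebesgue)"
    unfolding modular_def
  proof (rule nn_integral_mono_AE, use AE_inf AE_fin in eventually_elim)
    case (elim x)
    have abs: "cmod (f x / complex_of_real (B powr \<theta>)) = cmod (f x) / B powr \<theta>"
      using B by (simp add: norm_divide)
    show ?case
    proof (cases "p x = \<infinity>")
      case True
      then have "cmod (f x) / B powr \<theta> \<le> 1"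
        using elim f_le[of x] B by (simp add: divide_le_eq)
      then show ?thesis using True by (simp add: omega_mod_def abs)
    next
      case False
      then have fin: "p x < \<infinity>" by (simp add: less_top)
      define q n where "q = enn2real (p x)" and "n = enn2real \<nu>"
      have n: "\<nu> \<noteq> \<infinity>" "n \<le> q" and Bq: "B powr (q - n) \<le> B powr (\<theta> * q)"
        using elim fin by (auto simp: q_def n_def)
      have "(cmod (f x) / B powr \<theta>) powr q \<le> cmod (f x) powr n"
      proof (cases "f x = 0")
        case False
        have "(cmod (f x) / B powr \<theta>) powr q = cmod (f x) powr n * (cmod (f x) powr (q - n) / B powr (\<theta> * q))"
          using B False by (simp add: powr_divide powr_powr powr_diff)
        also have "\<dots> \<le> cmod (f x) powr n * (B powr (q - n) / B powr (\<theta> * q))"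
          using B n f_le[of x] by (intro mult_left_mono divide_right_mono powr_mono2) auto
        also have "\<dots> \<le> cmod (f x) powr n * 1"
          using B Bq by (intro mult_left_mono) (auto simp: divide_le_eq)
        finally show ?thesis by simp
      qed auto
      then show ?thesis
        using False n by (simp add: omega_mod_def abs q_def n_def ennreal_leI)
    qed
  qed
  also have "\<dots> \<le> 1"
  proof (cases "\<nu> = \<infinity>")
    case False
    then have "\<nu> < \<infinity>" by (simp add: less_top)
    with modf False show ?thesis by (simp add: modular_def)
  qed simp
  finally show ?thesis .
qed

section \<open>The Luxemburg norm and its modular\<close>

lemma omega_mod_mono: "0 \<le> s \<Longrightarrow> s \<le> s' \<Longrightarrow> omega_mod q s \<le> omega_mod q s'"
  by (auto simp: omega_mod_def intro!: ennreal_leI powr_mono2)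

text \<open>This keeps the real infimum in \<open>Lvar_norm\<close> meaningful. Since all exponents
  are at least 1, dividing the argument by m >= 1 divides the modular by at least m; m = max 1 I
  brings a finite modular I below 1.\<close>

lemma Lvar_modular_le_1:
  assumes f: "f \<in> Lvar p" and p: "p \<in> exponents"
  shows "{c. c > 0 \<and> modular p (\<lambda>x. f x / complex_of_real c) \<le> 1} \<noteq> {}"
proof -
  have [measurable]: "f \<in> borel_measurable lebesgue" "p \<in> borel_measurable lebesgue"
    using f p by (auto simp: Lvar_def exponents_def)
  obtain a where a: "a > 0" "modular p (\<lambda>x. complex_of_real a * f x) < \<infinity>"
    using f by (auto simp: Lvar_def)
  define I where "I = enn2real (modular p (\<lambda>x. complex_of_real a * f x))"
  have I: "modular p (\<lambda>x. complex_of_real a * f x) = ennreal I"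
    using a by (simp add: I_def)
  define m where "m = max 1 I"
  have m: "m \<ge> 1" "I \<le> m" by (auto simp: m_def)
  have "m / a \<in> {c. c > 0 \<and> modular p (\<lambda>x. f x / complex_of_real c) \<le> 1}"
  proof -
    have "omega_mod (p x) (cmod (f x / complex_of_real (m / a)))
        \<le> ennreal (1 / m) * omega_mod (p x) (cmod (complex_of_real a * f x))" for x
    proof -
      have abs: "cmod (f x / complex_of_real (m / a)) = cmod (complex_of_real a * f x) / m"
        using a m by (simp add: norm_divide norm_mult)
      define s where "s = cmod (complex_of_real a * f x)"
      have s: "s \<ge> 0" "s / m \<le> s"
        using m mult_left_mono[of 1 m s] by (auto simp: s_def divide_le_eq)
      show ?thesis
      proof (cases "p x = \<infinity>")
        case True
        then show ?thesis using s m
          unfolding omega_mod_def abs s_def[symmetric] by (auto simp: ennreal_mult_top)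
      next
        case False
        define q where "q = enn2real (p x)"
        have "1 \<le> p x" using p by (auto simp: exponents_def)
        then have q: "q \<ge> 1"
          using False unfolding q_def by (cases "p x") auto
        have "(s / m) powr q = (1 / m) powr q * s powr q"
          using s m by (simp add: powr_divide)
        also have "\<dots> \<le> (1 / m) powr 1 * s powr q"
          using q m by (intro mult_right_mono powr_mono') auto
        finally show ?thesis
          using False m s unfolding omega_mod_def abs s_def[symmetric]
          by (simp add: q_def ennreal_leI flip: ennreal_mult)
      qed
    qed
    then have "modular p (\<lambda>x. f x / complex_of_real (m / a))
        \<le> (\<integral>\<^sup>+x. ennreal (1 / m) * omega_mod (p x) (cmod (complex_of_real a * f x)) \<partial>lebesgue)"
      unfolding modular_def by (intro nn_integral_mono)
    also have "\<dots> = ennreal (1 / m) * modular p (\<lambda>x. complex_of_real a * f x)"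
      unfolding modular_def by (rule nn_integral_cmult) (unfold omega_mod_def, measurable)
    also have "\<dots> \<le> 1"
      using m unfolding I by (simp flip: ennreal_mult')
    finally show ?thesis using a m by simp
  qed
  then show ?thesis by blast
qed

lemma Lvar_norm_nonneg: "f \<in> Lvar p \<Longrightarrow> p \<in> exponents \<Longrightarrow> 0 \<le> Lvar_norm p f"
  unfolding Lvar_norm_def by (rule cInf_greatest[OF Lvar_modular_le_1]) auto

text \<open>With a strict inequality a smaller admissible constant exists and monotonicity finishes;
  attainment of the infimum never has to be discussed.\<close>

lemma modular_divide_le_1:
  assumes f: "f \<in> Lvar p" and c: "Lvar_norm p f < c" and p: "p \<in> exponents"
  shows "modular p (\<lambda>x. f x / complex_of_real c) \<le> 1"
proof -
  obtain c' where c': "c' > 0" "modular p (\<lambda>x. f x / complex_of_real c') \<le> 1" "c' < c"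
    using c cInf_lessD[OF Lvar_modular_le_1[OF f p]] unfolding Lvar_norm_def by blast
  have "modular p (\<lambda>x. f x / complex_of_real c) \<le> modular p (\<lambda>x. f x / complex_of_real c')"
    unfolding modular_def
    using c' by (intro nn_integral_mono omega_mod_mono) (auto simp: norm_divide intro!: divide_left_mono)
  then show ?thesis using c' by auto
qed

lemma Lvar_normI:
  assumes "f \<in> borel_measurable lebesgue" "c > 0" "modular p (\<lambda>x. f x / complex_of_real c) \<le> 1"
  shows "f \<in> Lvar p" "Lvar_norm p f \<le> c"
proof -
  have "(\<lambda>x. complex_of_real (1 / c) * f x) = (\<lambda>x. f x / complex_of_real c)" by auto
  then have "modular p (\<lambda>x. complex_of_real (1 / c) * f x) \<le> 1" using assms(3) by (simp only:)
  then have "modular p (\<lambda>x. complex_of_real (1 / c) * f x) < \<infinity>"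
    by (rule le_less_trans) simp
  then show "f \<in> Lvar p" unfolding Lvar_def
    using assms(1,2) by (intro CollectI conjI exI[of _ "1 / c"]) (simp_all only: zero_less_divide_1_iff)
  show "Lvar_norm p f \<le> c" unfolding Lvar_norm_def
    by (rule cInf_lower) (use assms in \<open>auto intro!: bdd_belowI[of _ 0]\<close>)
qed

text \<open>The supremum runs over an uncountable set, so its exceptional null sets cannot be united
  directly; a sequence with the same supremum reduces this to a countable union.\<close>

lemma AE_essinf: "AE x in M. essinf M f \<le> f x"
proof -
  let ?S = "{z. AE x in M. z \<le> f x}"
  have "0 \<in> ?S" by simp
  then obtain u :: "nat \<Rightarrow> ennreal" where u: "range u \<subseteq> ?S" "Sup ?S = (SUP i. u i)"
    using ennreal_Sup_countable_SUP[of ?S] by blast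
  have "AE x in M. \<forall>i. u i \<le> f x"
    using u(1) by (auto simp: AE_all_countable)
  then show ?thesis
    unfolding essinf_def u(2) by eventually_elim (simp add: SUP_le_iff)
qed

lemma essinf_ge_1: "p \<in> exponents \<Longrightarrow> 1 \<le> essinf lebesgue p"
  unfolding essinf_def by (rule Sup_upper) (simp add: exponents_def)

text \<open>The exponents \<rho> and \<theta> stay free. The four almost-everywhere conditions are
  exactly what the splitting at B = N^\<rho> and the interpolation ask for, in a form that is
  neutral between N >= 1 and N <= 1.\<close>

lemma conv_Lvar_bound:
  assumes k [measurable]: "k \<in> borel_measurable borel" and D: "D > 0" and N: "N > 0"
    and kN: "\<And>x. cmod (k x) \<le> D * N"
    and kD: "(\<integral>\<^sup>+x. ennreal (cmod (k x)) \<partial>lborel) \<le> ennreal D"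
    and p: "p \<in> exponents" and r: "r \<in> exponents" and \<nu>: "1 \<le> \<nu>"
    and \<phi>: "\<phi> \<in> Lvar r" "\<phi> \<in> Lconst \<nu>"
    and r_inf: "AE y in lebesgue. r y = \<infinity> \<longrightarrow> 1 \<le> N powr \<rho>"
    and r_fin: "AE y in lebesgue. r y < \<infinity> \<longrightarrow> N \<le> N powr (\<rho> * enn2real (r y))"
    and p_inf: "AE x in lebesgue. p x = \<infinity> \<longrightarrow> N powr \<rho> \<le> N powr (\<rho> * \<theta>)"
    and p_fin: "AE x in lebesgue. p x < \<infinity> \<longrightarrow> \<nu> < \<infinity> \<and> enn2real \<nu> \<le> enn2real (p x) \<and>
      N powr (\<rho> * (enn2real (p x) - enn2real \<nu>)) \<le> N powr (\<rho> * (\<theta> * enn2real (p x)))"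
  shows "conv k \<phi> \<in> Lvar p \<and>
    Lvar_norm p (conv k \<phi>) \<le> 2 * D * N powr (\<rho> * \<theta>) * max (Lvar_norm r \<phi>) (Lconst_norm \<nu> \<phi>)"
proof -
  define m where "m = max (Lvar_norm r \<phi>) (Lconst_norm \<nu> \<phi>)"
  have \<nu>_exp: "(\<lambda>_. \<nu>) \<in> exponents" using \<nu> by (simp add: exponents_def)
  have [measurable]: "\<phi> \<in> borel_measurable lebesgue" using \<phi> by (simp add: Lvar_def)
  have m0: "m \<ge> 0" using Lvar_norm_nonneg[OF \<phi>(1) r] by (simp add: m_def)
  have meas: "conv k \<phi> \<in> borel_measurable lebesgue"
    using borel_measurable_conv[OF k \<open>\<phi> \<in> borel_measurable lebesgue\<close>] by (auto intro: measurable_completion)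
  \<comment> \<open>Normalisation is by c > m instead of m, since m may be 0 and since
    \<open>modular_divide_le_1\<close> needs a strict inequality.\<close>
  have main: "conv k \<phi> \<in> Lvar p \<and> Lvar_norm p (conv k \<phi>) \<le> 2 * D * N powr (\<rho> * \<theta>) * c" if c: "c > m" for c
  proof -
    define \<psi> where "\<psi> = (\<lambda>x. \<phi> x / complex_of_real c)"
    have c0: "c > 0" using c m0 by simp
    have \<psi> [measurable]: "\<psi> \<in> borel_measurable lebesgue" unfolding \<psi>_def by measurable
    have mod_r: "modular r \<psi> \<le> 1"
      using modular_divide_le_1[OF \<phi>(1) _ r] c by (simp add: m_def \<psi>_def)
    have mod_\<nu>: "modular (\<lambda>_. \<nu>) \<psi> \<le> 1"
      using modular_divide_le_1[OF \<phi>(2) _ \<nu>_exp] c by (simp add: m_def \<psi>_def)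
    \<comment> \<open>Dividing by 2D cancels the constant of the supremum bound and leaves |f| <=
      N^\<rho>; Young's inequality then gives a \<nu>-modular of at most (1/2)^q <= 1.\<close>
    define f where "f = (\<lambda>x. conv k \<psi> x / complex_of_real (2 * D))"
    have f_eq: "f x = conv k \<phi> x / complex_of_real (2 * D * c)" for x
      by (simp add: f_def conv_def \<psi>_def)
    have "cmod (conv k \<psi> x) \<le> 2 * D * N powr \<rho>" for x
      by (rule cmod_conv_le_modular[OF k \<psi> r mod_r D N kN kD r_inf r_fin])
    then have f_le: "cmod (f x) \<le> N powr \<rho>" for x
      using D by (simp add: f_def norm_divide norm_mult divide_le_eq mult_ac)
    have mod_f: "modular (\<lambda>_. \<nu>) f \<le> 1" if "\<nu> < \<infinity>"
    proof -
      define q where "q = enn2real \<nu>"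
      have q: "\<nu> = ennreal q" "q \<ge> 1"
        using that \<nu> unfolding q_def by (cases \<nu>; simp)+
      have mod_eq: "modular (\<lambda>_. \<nu>) g = (\<integral>\<^sup>+x. ennreal (cmod (g x) powr q) \<partial>lebesgue)" for g :: "'a \<Rightarrow> complex"
        using q by (simp add: modular_def omega_mod_def)
      have [measurable]: "conv k \<psi> \<in> borel_measurable lebesgue"
        using borel_measurable_conv[OF k \<psi>] by (auto intro: measurable_completion)
      have "modular (\<lambda>_. \<nu>) f = (\<integral>\<^sup>+x. ennreal ((1 / (2 * D)) powr q) * ennreal (cmod (conv k \<psi> x) powr q) \<partial>lebesgue)"
        unfolding mod_eq f_def using D
        by (intro nn_integral_cong) (simp add: norm_divide norm_mult powr_divide flip: ennreal_mult)
      also have "\<dots> = ennreal ((1 / (2 * D)) powr q) * (\<integral>\<^sup>+x. ennreal (cmod (conv k \<psi> x) powr q) \<partial>lebesgue)"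
        by (rule nn_integral_cmult) measurable
      also have "\<dots> \<le> ennreal ((1 / (2 * D)) powr q) * (ennreal (D powr q) * 1)"
        using young_conv[OF k \<psi> q(2) D kD] mod_\<nu>
        unfolding mod_eq by (intro mult_left_mono) (auto elim!: order_trans intro: mult_left_le)
      also have "\<dots> = ennreal ((1 / 2) powr q)"
        using D by (simp add: powr_divide powr_mult flip: ennreal_mult)
      also have "\<dots> \<le> 1"
        using q by (simp add: powr_le1)
      finally show ?thesis .
    qed
    have "modular p (\<lambda>x. f x / complex_of_real ((N powr \<rho>) powr \<theta>)) \<le> 1"
      by (rule modular_interpolate[OF _ f_le mod_f]) (use N p_inf p_fin in \<open>auto simp: powr_powr\<close>)
    then have "modular p (\<lambda>x. conv k \<phi> x / complex_of_real (2 * D * N powr (\<rho> * \<theta>) * c)) \<le> 1"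
      by (simp add: f_eq powr_powr mult_ac)
    moreover have "2 * D * N powr (\<rho> * \<theta>) * c > 0" using D N c0 by simp
    ultimately show ?thesis using Lvar_normI[OF meas] by blast
  qed
  \<comment> \<open>The limit of c towards m.\<close>
  have "Lvar_norm p (conv k \<phi>) \<le> 2 * D * N powr (\<rho> * \<theta>) * m"
  proof (rule field_le_epsilon)
    fix e :: real assume e: "e > 0"
    define a where "a = 2 * D * N powr (\<rho> * \<theta>)"
    have "a > 0" using D N by (simp add: a_def)
    with main[of "m + e / a"] e show "Lvar_norm p (conv k \<phi>) \<le> 2 * D * N powr (\<rho> * \<theta>) * m + e"
      by (simp add: a_def[symmetric] distrib_left)
  qed
  moreover have "conv k \<phi> \<in> Lvar p" using main[of "m + 1"] by simp
  ultimately show ?thesis by (simp add: m_def)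
qed

section \<open>Choice of the exponents for small and for large times\<close>

lemma enn2real_divide_ennreal:
  "0 \<le> a \<Longrightarrow> 0 < b \<Longrightarrow> enn2real (ennreal a / ennreal b) = a / b"
  by (simp add: divide_ennreal)

text \<open>For N >= 1 the conditions read \<rho> r >= 1 and \<theta> p >= p - \<nu> almost
  everywhere, which \<rho> = 1/r^- and \<theta> = 1 - \<nu>/p^+ satisfy. For N <= 1 both
  inequalities reverse, and r^+ and p^- take over.\<close>

lemma conv_Lvar_decay:
  fixes p r :: "'a::euclidean_space \<Rightarrow> ennreal"
  assumes k: "k \<in> borel_measurable borel" and D: "D > 0" and N: "N > 0"
    and N1: "t \<le> 1 \<Longrightarrow> 1 \<le> N" "1 < t \<Longrightarrow> N \<le> 1"
    and kN: "\<And>x. cmod (k x) \<le> D * N"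
    and kD: "(\<integral>\<^sup>+x. ennreal (cmod (k x)) \<partial>lborel) \<le> ennreal D"
    and p: "p \<in> exponents" and r: "r \<in> exponents" and \<nu>: "1 \<le> \<nu>" "\<nu> \<le> essinf lebesgue p"
    and \<phi>: "\<phi> \<in> Lvar r" "\<phi> \<in> Lconst \<nu>"
  shows "conv k \<phi> \<in> Lvar p \<and>
    Lvar_norm p (conv k \<phi>) \<le> 2 * D * N powr decay_omega p r \<nu> t * max (Lvar_norm r \<phi>) (Lconst_norm \<nu> \<phi>)"
proof -
  note bound = conv_Lvar_bound[OF k D N kN kD p r \<nu>(1) \<phi>]
  have p1: "1 \<le> p x" and r1: "1 \<le> r x" for x using p r by (auto simp: exponents_def)
  have fin: "1 \<le> enn2real x" "ennreal (enn2real x) = x" if "1 \<le> x" "x < \<infinity>" for x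
    using that by (cases x; simp)+
  show ?thesis
  proof (cases "t \<le> 1")
    case True
    note N1 = N1(1)[OF True]
    define a b where "a = essinf lebesgue r" and "b = esssup lebesgue p"
    define \<rho> \<theta> where "\<rho> = enn2real (1 / a)" and "\<theta> = 1 - enn2real (\<nu> / b)"
    have a1: "1 \<le> a" using essinf_ge_1[OF r] by (simp add: a_def)
    have \<rho>: "\<rho> \<ge> 0" by (simp add: \<rho>_def)
    have "AE y in lebesgue. r y < \<infinity> \<longrightarrow> 1 \<le> \<rho> * enn2real (r y)"
      using AE_essinf[of lebesgue r]
    proof eventually_elim
      case (elim y)
      show ?case
      proof
        assume y: "r y < \<infinity>"
        then have a: "a < \<infinity>" using elim by (auto simp: a_def)
        have "\<rho> = 1 / enn2real a"
          using fin[OF a1 a] enn2real_divide_ennreal[of 1 "enn2real a"] by (simp add: \<rho>_def)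
        moreover have "enn2real a \<le> enn2real (r y)"
          using elim y by (intro enn2real_mono) (auto simp: a_def)
        ultimately show "1 \<le> \<rho> * enn2real (r y)" using fin(1)[OF a1 a] by simp
      qed
    qed
    then have "AE y in lebesgue. r y < \<infinity> \<longrightarrow> N \<le> N powr (\<rho> * enn2real (r y))"
      using N N1 powr_mono[of 1 _ N] by auto
    moreover have "AE y in lebesgue. r y = \<infinity> \<longrightarrow> 1 \<le> N powr \<rho>"
      using N1 \<rho> by (simp add: ge_one_powr_ge_zero)
    moreover have "AE x in lebesgue. p x = \<infinity> \<longrightarrow> N powr \<rho> \<le> N powr (\<rho> * \<theta>)"
      using esssup_AE[of p lebesgue]
    proof eventually_elim
      case (elim x)
      \<comment> \<open>Here p^+ is infinite and \<nu>/p^+ = 0, including the case of infinite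
        \<nu>.\<close>
      then have "p x = \<infinity> \<Longrightarrow> \<theta> = 1" by (simp add: \<theta>_def b_def[symmetric] top_unique)
      then show ?case by auto
    qed
    moreover have "AE x in lebesgue. p x < \<infinity> \<longrightarrow> \<nu> < \<infinity> \<and> enn2real \<nu> \<le> enn2real (p x) \<and>
      N powr (\<rho> * (enn2real (p x) - enn2real \<nu>)) \<le> N powr (\<rho> * (\<theta> * enn2real (p x)))"
      using esssup_AE[of p lebesgue] AE_essinf[of lebesgue p]
    proof eventually_elim
      case (elim x)
      show ?case
      proof (intro impI conjI)
        assume x: "p x < \<infinity>"
        have le: "\<nu> \<le> p x" using elim \<nu> by auto
        then show \<nu>_fin: "\<nu> < \<infinity>" using x by auto
        show le': "enn2real \<nu> \<le> enn2real (p x)" using le x by (intro enn2real_mono) auto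
        have "enn2real (\<nu> / b) * enn2real (p x) \<le> enn2real \<nu>"
        proof (cases "b = \<infinity>")
          case False
          then have b: "b < \<infinity>" by (simp add: less_top)
          have b1: "1 \<le> b" using elim p1[of x] by (auto simp: b_def)
          have "enn2real (\<nu> / b) = enn2real \<nu> / enn2real b"
            using fin[OF b1 b] fin[OF \<nu>(1) \<nu>_fin] enn2real_divide_ennreal[of "enn2real \<nu>" "enn2real b"] by simp
          moreover have "enn2real (p x) \<le> enn2real b"
            using elim b by (intro enn2real_mono) (auto simp: b_def)
          ultimately show ?thesis
            using fin(1)[OF b1 b] by (auto simp: divide_le_eq intro!: mult_left_mono)
        qed simp
        then show "N powr (\<rho> * (enn2real (p x) - enn2real \<nu>)) \<le> N powr (\<rho> * (\<theta> * enn2real (p x)))"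
          using N1 \<rho> by (intro powr_mono mult_left_mono) (auto simp: \<theta>_def algebra_simps)
      qed
    qed
    ultimately show ?thesis
      using bound[of \<rho> \<theta>] True by (simp add: decay_omega_def \<rho>_def \<theta>_def a_def b_def)
  next
    case False
    then have N1: "N \<le> 1" using N1 by simp
    define a b where "a = esssup lebesgue r" and "b = essinf lebesgue p"
    define \<rho> \<theta> where "\<rho> = enn2real (1 / a)" and "\<theta> = 1 - enn2real (\<nu> / b)"
    have b1: "1 \<le> b" using essinf_ge_1[OF p] by (simp add: b_def)
    have \<rho>: "\<rho> \<ge> 0" by (simp add: \<rho>_def)
    have "AE y in lebesgue. r y < \<infinity> \<longrightarrow> \<rho> * enn2real (r y) \<le> 1"
      using esssup_AE[of r lebesgue]
    proof eventually_elim
      case (elim y)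
      show ?case
      proof (cases "a = \<infinity>")
        case False
        then have a: "a < \<infinity>" by (simp add: less_top)
        have a1: "1 \<le> a" using elim r1[of y] by (auto simp: a_def)
        have "\<rho> = 1 / enn2real a"
          using fin[OF a1 a] enn2real_divide_ennreal[of 1 "enn2real a"] by (simp add: \<rho>_def)
        moreover have "enn2real (r y) \<le> enn2real a"
          using elim a by (intro enn2real_mono) (auto simp: a_def)
        ultimately show ?thesis using fin(1)[OF a1 a] by (simp add: divide_le_eq)
      qed (simp add: \<rho>_def)
    qed
    then have "AE y in lebesgue. r y < \<infinity> \<longrightarrow> N \<le> N powr (\<rho> * enn2real (r y))"
      using N N1 powr_mono'[of _ 1 N] by auto
    moreover have "AE y in lebesgue. r y = \<infinity> \<longrightarrow> 1 \<le> N powr \<rho>"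
      using esssup_AE[of r lebesgue]
    proof eventually_elim
      case (elim y)
      \<comment> \<open>An infinite r^+ gives \<rho> = 0, that is height B = 1: just what points of
        infinite exponent require when N <= 1.\<close>
      then have "r y = \<infinity> \<Longrightarrow> \<rho> = 0" by (simp add: \<rho>_def a_def[symmetric] top_unique)
      then show ?case using N by auto
    qed
    moreover have "AE x in lebesgue. p x = \<infinity> \<longrightarrow> N powr \<rho> \<le> N powr (\<rho> * \<theta>)"
      using N N1 \<rho> by (intro AE_I2 impI powr_mono' mult_left_le) (auto simp: \<theta>_def)
    moreover have "AE x in lebesgue. p x < \<infinity> \<longrightarrow> \<nu> < \<infinity> \<and> enn2real \<nu> \<le> enn2real (p x) \<and>
      N powr (\<rho> * (enn2real (p x) - enn2real \<nu>)) \<le> N powr (\<rho> * (\<theta> * enn2real (p x)))"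
      using AE_essinf[of lebesgue p]
    proof eventually_elim
      case (elim x)
      show ?case
      proof (intro impI conjI)
        assume x: "p x < \<infinity>"
        have le: "\<nu> \<le> p x" using elim \<nu> by auto
        then show \<nu>_fin: "\<nu> < \<infinity>" using x by auto
        show le': "enn2real \<nu> \<le> enn2real (p x)" using le x by (intro enn2real_mono) auto
        have b: "b < \<infinity>" using elim x by (auto simp: b_def)
        have "enn2real (\<nu> / b) = enn2real \<nu> / enn2real b"
          using fin[OF b1 b] fin[OF \<nu>(1) \<nu>_fin] enn2real_divide_ennreal[of "enn2real \<nu>" "enn2real b"] by simp
        moreover have "enn2real b \<le> enn2real (p x)"
          using elim x by (intro enn2real_mono) (auto simp: b_def)
        ultimately have "enn2real \<nu> \<le> enn2real (\<nu> / b) * enn2real (p x)"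
          using fin(1)[OF b1 b] by (auto simp: le_divide_eq intro!: mult_left_mono)
        then show "N powr (\<rho> * (enn2real (p x) - enn2real \<nu>)) \<le> N powr (\<rho> * (\<theta> * enn2real (p x)))"
          using N N1 \<rho> by (intro powr_mono' mult_left_mono) (auto simp: \<theta>_def algebra_simps)
      qed
    qed
    ultimately show ?thesis
      using bound[of \<rho> \<theta>] False by (simp add: decay_omega_def \<rho>_def \<theta>_def a_def b_def)
  qed
qed

section \<open>Bochner--Riesz means\<close>

text \<open>Unlike \<open>inv_fourier\<close>, this carries no constant and integrates over
  \<open>lborel\<close>, where product measures and linear substitutions are available; it serves as
  both transforms in the inversion theorem.\<close>

definition ift :: "('a::euclidean_space \<Rightarrow> complex) \<Rightarrow> 'a \<Rightarrow> complex" where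
  "ift h x = (LINT \<xi>|lborel. cis (x \<bullet> \<xi>) * h \<xi>)"

lemma borel_measurable_cis [measurable]: "cis \<in> borel_measurable borel"
  by (intro borel_measurable_continuous_onI continuous_intros)

lemma norm_cis_mult [simp]: "cmod (cis a * z) = cmod z"
  by (simp add: norm_mult)

lemma integrable_cis_mult:
  assumes "integrable lborel h"
  shows "integrable lborel (\<lambda>\<xi>. cis (x \<bullet> \<xi>) * h \<xi>)"
proof (rule Bochner_Integration.integrable_bound[OF assms])
  have [measurable]: "h \<in> borel_measurable borel" using assms by auto
  show "(\<lambda>\<xi>. cis (x \<bullet> \<xi>) * h \<xi>) \<in> borel_measurable lborel" by measurable
qed simp

lemma cmod_ift_le: "cmod (ift h x) \<le> (LINT \<xi>|lborel. cmod (h \<xi>))"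
  using integral_norm_bound[of lborel "\<lambda>\<xi>. cis (x \<bullet> \<xi>) * h \<xi>"] by (simp add: ift_def)

lemma continuous_ift:
  assumes "integrable lborel h"
  shows "continuous_on UNIV (ift h)"
  unfolding continuous_on_sequentially comp_def
proof (intro ballI allI impI)
  fix a and X :: "nat \<Rightarrow> 'a" assume "(\<forall>n. X n \<in> UNIV) \<and> X \<longlonglongrightarrow> a"
  then have X: "X \<longlonglongrightarrow> a" by simp
  have [measurable]: "h \<in> borel_measurable borel" using assms by auto
  show "(\<lambda>n. ift h (X n)) \<longlonglongrightarrow> ift h a"
    unfolding ift_def
  proof (rule integral_dominated_convergence[where w = "\<lambda>\<xi>. cmod (h \<xi>)"])
    have "(\<lambda>n. cis (X n \<bullet> \<xi>) * h \<xi>) \<longlonglongrightarrow> cis (a \<bullet> \<xi>) * h \<xi>" for \<xi>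
      unfolding cis_conv_exp by (intro tendsto_intros X)
    then show "AE \<xi> in lborel. (\<lambda>n. cis (X n \<bullet> \<xi>) * h \<xi>) \<longlonglongrightarrow> cis (a \<bullet> \<xi>) * h \<xi>" by simp
  qed (use assms in \<open>auto intro: integrable_norm\<close>)
qed

lemma borel_measurable_ift:
  "integrable lborel h \<Longrightarrow> ift h \<in> borel_measurable borel"
  by (intro borel_measurable_continuous_onI continuous_ift)

lemma ift_add:
  assumes "integrable lborel g" "integrable lborel h"
  shows "ift (\<lambda>\<xi>. g \<xi> + h \<xi>) x = ift g x + ift h x"
  using integrable_cis_mult[OF assms(1), of x] integrable_cis_mult[OF assms(2), of x]
  by (simp add: ift_def distrib_left)

lemma ift_scale:
  fixes h :: "'a::euclidean_space \<Rightarrow> complex"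
  assumes "c > 0"
  shows "ift (\<lambda>\<xi>. h (\<xi> /\<^sub>R c)) x = of_real (c ^ DIM('a)) * ift h (c *\<^sub>R x)"
  unfolding ift_def using assms
  by (subst integral_lborel_affine[where c = c and a = 0]) (auto simp: scaleR_conv_of_real)

lemma ift_translate: "ift (\<lambda>\<xi>. h (\<xi> + b)) x = cis (- (x \<bullet> b)) * ift h x"
proof -
  have "ift h x = (LINT \<xi>|lborel. cis (x \<bullet> (b + \<xi>)) * h (b + \<xi>))"
    unfolding ift_def by (subst integral_lborel_affine[where c = 1 and a = b]) simp_all
  also have "\<dots> = (LINT \<xi>|lborel. cis (x \<bullet> b) * (cis (x \<bullet> \<xi>) * h (\<xi> + b)))"
    by (simp add: inner_add_right add.commute mult_ac flip: cis_mult)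
  also have "\<dots> = cis (x \<bullet> b) * ift (\<lambda>\<xi>. h (\<xi> + b)) x"
    by (simp add: ift_def)
  finally have "cis (- (x \<bullet> b)) * ift h x = (cis (- (x \<bullet> b)) * cis (x \<bullet> b)) * ift (\<lambda>\<xi>. h (\<xi> + b)) x"
    by (simp add: mult.assoc)
  then show ?thesis by (simp add: cis_mult)
qed

text \<open>The weight is dominated by a sum over dyadic balls: the k-th ball has volume
  proportional to 2^(kn) and carries the height (2/2^k)^(n+1), so the terms form a geometric series
  of ratio 1/2.\<close>

lemma integrable_decay_weight:
  "integrable lborel (\<lambda>x::'a::euclidean_space. 1 / (1 + norm x) ^ Suc DIM('a))"
proof (rule integrableI_bounded)
  let ?n = "DIM('a)" and ?B = "\<lambda>k. ball (0::'a) (2 ^ k)"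
  define c where "c k = (2 / 2 ^ k :: real) ^ Suc ?n" for k :: nat
  define V where "V = measure lborel (ball (0::'a) 1)"
  have le: "ennreal (norm (1 / (1 + norm x) ^ Suc ?n)) \<le> (\<Sum>k. ennreal (c k) * indicator (?B k) x)" for x
  proof -
    define f where "f k = ennreal (c k) * indicator (?B k) x" for k
    obtain m :: nat where "norm x < 2 ^ m"
      using real_arch_pow[of 2 "norm x"] by auto
    \<comment> \<open>Minimality of k is what gives 2^k <= 2(1 + |x|); for k = 0 this holds
      trivially.\<close>
    define k where "k = (LEAST m. norm x < 2 ^ m)"
    have k: "norm x < 2 ^ k" unfolding k_def by (rule LeastI) fact
    have "2 ^ k \<le> 2 * (1 + norm x)"
    proof (cases k)
      case (Suc j)
      then have "\<not> norm x < 2 ^ j" using not_less_Least[of j "\<lambda>m. norm x < 2 ^ m"] k_def by auto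
      then show ?thesis using Suc by simp
    qed simp
    then have "1 / (1 + norm x) \<le> 2 / 2 ^ k"
      by (simp add: field_simps pos_divide_le_eq add_pos_nonneg)
    then have "(1 / (1 + norm x)) ^ Suc ?n \<le> c k"
      unfolding c_def by (intro power_mono) auto
    then have "norm (1 / (1 + norm x) ^ Suc ?n) \<le> c k"
      by (simp add: power_divide abs_of_nonneg del: power_Suc)
    then have "ennreal (norm (1 / (1 + norm x) ^ Suc ?n)) \<le> ennreal (c k) * indicator (?B k) x"
      using k by (simp add: ennreal_leI)
    also have "\<dots> \<le> (\<Sum>k. ennreal (c k) * indicator (?B k) x)"
      unfolding f_def[symmetric] using sum_le_suminf[of f "{k}"] by simp
    finally show ?thesis .
  qed
  have em: "emeasure lborel (?B k) = ennreal ((2 ^ k) ^ ?n * V)" for k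
    using content_ball_conv_unit_ball[of "2 ^ k" "0::'a"] emeasure_lborel_ball_finite[of "0::'a" "2 ^ k"]
    by (subst emeasure_eq_ennreal_measure) (auto simp: V_def)
  have "(\<integral>\<^sup>+x. ennreal (norm (1 / (1 + norm (x::'a)) ^ Suc ?n)) \<partial>lborel)
      \<le> (\<integral>\<^sup>+x. (\<Sum>k. ennreal (c k) * indicator (?B k) x) \<partial>lborel)"
    by (intro nn_integral_mono le)
  also have "\<dots> = (\<Sum>k. \<integral>\<^sup>+x. ennreal (c k) * indicator (?B k) x \<partial>lborel)"
  proof (rule nn_integral_suminf)
    fix k
    have [measurable]: "?B k \<in> sets borel" by simp
    show "(\<lambda>x. ennreal (c k) * indicator (?B k) x) \<in> borel_measurable lborel" by measurable
  qed
  also have "\<dots> = (\<Sum>k. ennreal (c k) * emeasure lborel (?B k))"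
    by (intro suminf_cong nn_integral_cmult_indicator) auto
  also have "\<dots> = (\<Sum>k. ennreal (2 ^ Suc ?n * V * (1 / 2) ^ k))"
  proof (rule suminf_cong)
    fix k
    have "c k * ((2 ^ k) ^ ?n * V) = 2 ^ Suc ?n * V * (1 / 2) ^ k"
      by (simp add: c_def power_divide field_simps)
    moreover have "V \<ge> 0" "c k \<ge> 0" by (simp_all add: V_def c_def)
    ultimately show "ennreal (c k) * emeasure lborel (?B k) = ennreal (2 ^ Suc ?n * V * (1 / 2) ^ k)"
      unfolding em by (simp flip: ennreal_mult)
  qed
  also have "\<dots> = ennreal (\<Sum>k. 2 ^ Suc ?n * V * (1 / 2) ^ k)"
    by (intro suminf_ennreal2 summable_mult summable_geometric) (auto simp: V_def)
  also have "\<dots> < \<infinity>" by simp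
  finally show "(\<integral>\<^sup>+x. ennreal (norm (1 / (1 + norm (x::'a)) ^ Suc ?n)) \<partial>lborel) < \<infinity>" .
qed simp

text \<open>Integration by parts through difference quotients: translating \<open>h\<close>
  multiplies its transform by a phase, the quotient of the phase tends to -i (x . b), and dominated
  convergence treats the quotients of \<open>h\<close>. The mean value theorem and the compact
  support provide the majorant.\<close>

lemma ift_directional_derivative:
  fixes h h' :: "'a::euclidean_space \<Rightarrow> real"
  assumes deriv: "\<And>\<xi> s. ((\<lambda>s. h (\<xi> + s *\<^sub>R b)) has_real_derivative h' (\<xi> + s *\<^sub>R b)) (at s)"
    and bound: "\<And>\<xi>. \<bar>h' \<xi>\<bar> \<le> K" and supp: "\<And>\<xi>. R \<le> norm \<xi> \<Longrightarrow> h \<xi> = 0"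
    and b: "norm b = 1" and h: "integrable lborel h" and h': "h' \<in> borel_measurable borel"
  shows "ift (\<lambda>\<xi>. of_real (h' \<xi>)) x = - \<i> * of_real (x \<bullet> b) * ift (\<lambda>\<xi>. of_real (h \<xi>)) x"
proof -
  let ?s = "\<lambda>n::nat. 1 / real (Suc n)"
  define q where "q n \<xi> = (h (\<xi> + ?s n *\<^sub>R b) - h \<xi>) / ?s n" for n \<xi>
  have [measurable]: "h \<in> borel_measurable borel" using h by auto
  note h' [measurable]
  have int_shift: "integrable lborel (\<lambda>\<xi>. h (\<xi> + ?s n *\<^sub>R b))" for n
    using integrable_lborel_affine[OF h, of 1 "?s n *\<^sub>R b"] by (simp add: add.commute)
  have s0: "?s \<longlonglongrightarrow> 0" by (rule LIMSEQ_inverse_real_of_nat[unfolded inverse_eq_divide])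
  have "ift (\<lambda>\<xi>. of_real (q n \<xi>)) x = (cis (- (?s n * (x \<bullet> b))) - 1) / ?s n * ift (\<lambda>\<xi>. of_real (h \<xi>)) x" for n
  proof -
    have "ift (\<lambda>\<xi>. of_real (q n \<xi>)) x
        = (LINT \<xi>|lborel. cis (x \<bullet> \<xi>) * of_real (h (\<xi> + ?s n *\<^sub>R b)) - cis (x \<bullet> \<xi>) * of_real (h \<xi>)) / ?s n"
      unfolding ift_def q_def integral_divide_zero[symmetric]
      by (intro Bochner_Integration.integral_cong) (auto simp: diff_divide_distrib right_diff_distrib)
    also have "\<dots> = (ift (\<lambda>\<xi>. of_real (h (\<xi> + ?s n *\<^sub>R b))) x - ift (\<lambda>\<xi>. of_real (h \<xi>)) x) / ?s n"
      unfolding ift_def using int_shift[of n] h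
      by (subst Bochner_Integration.integral_diff) (auto intro!: integrable_cis_mult)
    also have "ift (\<lambda>\<xi>. of_real (h (\<xi> + ?s n *\<^sub>R b))) x = cis (- (?s n * (x \<bullet> b))) * ift (\<lambda>\<xi>. of_real (h \<xi>)) x"
      by (subst ift_translate) simp
    finally show ?thesis by (simp add: algebra_simps diff_divide_distrib)
  qed
  moreover have "(\<lambda>n. (cis (- (?s n * (x \<bullet> b))) - 1) / ?s n) \<longlonglongrightarrow> - \<i> * of_real (x \<bullet> b)"
  proof -
    have "((\<lambda>s. exp (- \<i> * of_real (x \<bullet> b) * s)) has_field_derivative - \<i> * of_real (x \<bullet> b)) (at (0::complex))"
      by (auto intro!: derivative_eq_intros)
    then have "((\<lambda>s. (exp (- \<i> * of_real (x \<bullet> b) * s) - 1) / s) \<longlongrightarrow> - \<i> * of_real (x \<bullet> b)) (at (0::complex))"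
      by (simp add: has_field_derivative_iff)
    moreover have "filterlim (\<lambda>n. complex_of_real (?s n)) (at 0) sequentially"
    proof (rule filterlim_atI)
      show "(\<lambda>n. complex_of_real (?s n)) \<longlonglongrightarrow> 0" using tendsto_of_real[OF s0, where 'a = complex] by (simp only: of_real_0)
      show "\<forall>\<^sub>F n in sequentially. complex_of_real (?s n) \<noteq> 0"
        by (intro always_eventually allI) (simp only: of_real_eq_0_iff, simp)
    qed
    ultimately have "(\<lambda>n. (exp (- \<i> * of_real (x \<bullet> b) * of_real (?s n)) - 1) / of_real (?s n)) \<longlonglongrightarrow> - \<i> * of_real (x \<bullet> b)"
      by (rule filterlim_compose)
    then show ?thesis by (simp add: cis_conv_exp mult_ac)
  qed
  ultimately have "(\<lambda>n. ift (\<lambda>\<xi>. of_real (q n \<xi>)) x) \<longlonglongrightarrow> - \<i> * of_real (x \<bullet> b) * ift (\<lambda>\<xi>. of_real (h \<xi>)) x"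
    by (simp only: tendsto_mult_right)
  moreover have "(\<lambda>n. ift (\<lambda>\<xi>. of_real (q n \<xi>)) x) \<longlonglongrightarrow> ift (\<lambda>\<xi>. of_real (h' \<xi>)) x"
    unfolding ift_def
  \<comment> \<open>The radius R + 1 allows for steps of length at most 1: beyond it both values in
    the difference quotient vanish.\<close>
  proof (rule integral_dominated_convergence[where w = "\<lambda>\<xi>. K * indicator (cball 0 (R + 1)) \<xi>"])
    show "AE \<xi> in lborel. (\<lambda>n. cis (x \<bullet> \<xi>) * of_real (q n \<xi>)) \<longlonglongrightarrow> cis (x \<bullet> \<xi>) * of_real (h' \<xi>)"
    proof (intro AE_I2 tendsto_mult_left tendsto_of_real)
      fix \<xi>
      have "((\<lambda>s. (h (\<xi> + s *\<^sub>R b) - h \<xi>) / s) \<longlongrightarrow> h' \<xi>) (at 0)"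
        using deriv[of \<xi> 0] by (simp add: has_field_derivative_iff)
      moreover have "filterlim ?s (at 0) sequentially"
        unfolding filterlim_at using s0 by simp
      ultimately show "(\<lambda>n. q n \<xi>) \<longlonglongrightarrow> h' \<xi>"
        unfolding q_def by (rule filterlim_compose)
    qed
    show "AE \<xi> in lborel. norm (cis (x \<bullet> \<xi>) * of_real (q n \<xi>)) \<le> K * indicator (cball 0 (R + 1)) \<xi>" for n
    proof (rule AE_I2)
      fix \<xi>
      have s: "0 < ?s n" "?s n \<le> 1" by auto
      have K: "K \<ge> 0" using bound[of 0] by linarith
      show "norm (cis (x \<bullet> \<xi>) * of_real (q n \<xi>)) \<le> K * indicator (cball 0 (R + 1)) \<xi>"
      proof (cases "norm \<xi> \<le> R + 1")
        case True
        obtain z where "h (\<xi> + ?s n *\<^sub>R b) - h (\<xi> + 0 *\<^sub>R b) = (?s n - 0) * h' (\<xi> + z *\<^sub>R b)"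
          using MVT2[of 0 "?s n" "\<lambda>s. h (\<xi> + s *\<^sub>R b)" "\<lambda>s. h' (\<xi> + s *\<^sub>R b)", OF s(1) deriv] by blast
        then have "q n \<xi> = h' (\<xi> + z *\<^sub>R b)" by (simp add: q_def)
        then show ?thesis using True bound by simp
      next
        case False
        have "norm \<xi> \<le> norm (\<xi> + ?s n *\<^sub>R b) + norm (?s n *\<^sub>R b)"
          using norm_triangle_ineq4[of "\<xi> + ?s n *\<^sub>R b" "?s n *\<^sub>R b"] by simp
        moreover have "norm (?s n *\<^sub>R b) \<le> 1" using b by simp
        ultimately have "R \<le> norm (\<xi> + ?s n *\<^sub>R b)"
          using False by linarith
        then have "q n \<xi> = 0" using supp False by (simp add: q_def)
        then show ?thesis using K by simp
      qed
    qed
    show "integrable lborel (\<lambda>\<xi>. K * indicator (cball 0 (R + 1)) (\<xi>::'a) :: real)"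
      using emeasure_lborel_cball_finite[of "0::'a" "R + 1"] by (intro integrable_mult_right integrable_real_indicator) auto
  qed (auto simp: q_def)
  ultimately show ?thesis by (rule LIMSEQ_unique[rotated])
qed

text \<open>For M = 0 this is the constant 1 and not the indicator of the ball, so compact support
  starts at M = 1.\<close>

definition bochner_riesz :: "nat \<Rightarrow> 'a::euclidean_space \<Rightarrow> real" where
  "bochner_riesz M \<xi> = max 0 (1 - (norm \<xi>)\<^sup>2) ^ M"

lemma borel_measurable_bochner_riesz [measurable]: "bochner_riesz M \<in> borel_measurable borel"
  unfolding bochner_riesz_def by measurable

lemma bochner_riesz_bounds: "0 \<le> bochner_riesz M \<xi>" "bochner_riesz M \<xi> \<le> 1"
  by (auto simp: bochner_riesz_def intro: power_le_one)

lemma bochner_riesz_eq_0: "M > 0 \<Longrightarrow> 1 \<le> norm \<xi> \<Longrightarrow> bochner_riesz M \<xi> = 0"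
  using one_le_power[of "norm \<xi>" 2] by (simp add: bochner_riesz_def max_absorb1)

text \<open>Exponents from 2 on remove the kink: at 0 the difference quotient is again a positive
  truncated power, which tends to 0.\<close>

lemma DERIV_truncated_power:
  "((\<lambda>y. max 0 y ^ Suc (Suc M)) has_real_derivative real (Suc (Suc M)) * max 0 y ^ Suc M) (at y)"
proof -
  consider "y > 0" | "y < 0" | "y = 0" by linarith
  then show ?thesis
  proof cases
    case 1
    have "((\<lambda>y. y ^ Suc (Suc M)) has_real_derivative real (Suc (Suc M)) * max 0 y ^ Suc M) (at y)"
      using DERIV_pow[of "Suc (Suc M)" y] 1 by (simp add: max_def)
    moreover have "\<forall>\<^sub>F z in nhds y. z ^ Suc (Suc M) = max 0 z ^ Suc (Suc M)"
      by (intro eventually_nhds_in_open[of "{0<..}", THEN eventually_mono]) (use 1 in auto)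
    ultimately show ?thesis by (subst (asm) DERIV_cong_ev[OF refl _ refl])
  next
    case 2
    have "((\<lambda>y. 0) has_real_derivative real (Suc (Suc M)) * max 0 y ^ Suc M) (at y)"
      using 2 by (auto simp: max_def)
    moreover have "\<forall>\<^sub>F z in nhds y. 0 = max 0 z ^ Suc (Suc M)"
      by (intro eventually_nhds_in_open[of "{..<0}", THEN eventually_mono]) (use 2 in \<open>auto simp: max_def\<close>)
    ultimately show ?thesis by (subst (asm) DERIV_cong_ev[OF refl _ refl])
  next
    case 3
    have "((\<lambda>h. max 0 h ^ Suc M) \<longlongrightarrow> max 0 0 ^ Suc M) (at (0::real))"
      by (intro tendsto_intros)
    then have "((\<lambda>h. max 0 h ^ Suc M) \<longlongrightarrow> 0) (at (0::real))" by simp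
    moreover have "\<forall>\<^sub>F h in at (0::real).
        max 0 h ^ Suc M = (max 0 (0 + h) ^ Suc (Suc M) - max 0 0 ^ Suc (Suc M)) / h"
      by (auto simp: eventually_at max_def intro!: exI[of _ 1])
    ultimately have "((\<lambda>h. (max 0 (0 + h) ^ Suc (Suc M) - max 0 0 ^ Suc (Suc M)) / h) \<longlongrightarrow> 0) (at (0::real))"
      by (rule Lim_transform_eventually)
    then show ?thesis using 3 by (simp add: DERIV_def)
  qed
qed

lemma DERIV_bochner_riesz:
  "((\<lambda>s. bochner_riesz (Suc (Suc M)) (\<xi> + s *\<^sub>R b)) has_real_derivative
     - 2 * real (Suc (Suc M)) * ((\<xi> + s *\<^sub>R b) \<bullet> b) * bochner_riesz (Suc M) (\<xi> + s *\<^sub>R b)) (at s)"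
proof -
  have "((\<lambda>s. 1 - (norm (\<xi> + s *\<^sub>R b))\<^sup>2) has_real_derivative - 2 * ((\<xi> + s *\<^sub>R b) \<bullet> b)) (at s)"
    unfolding power2_norm_eq_inner
    by (auto intro!: derivative_eq_intros has_derivative_imp_has_field_derivative
        simp: inner_add_left inner_add_right inner_commute algebra_simps)
  from DERIV_chain2[OF DERIV_truncated_power this, of M] show ?thesis
    unfolding bochner_riesz_def by (rule DERIV_cong) (simp only: mult_ac)
qed

section \<open>Decay of the transforms of Bochner--Riesz means\<close>

lemma bounded_poly_inner:
  fixes q :: "real poly" and b :: "'a::euclidean_space"
  obtains K where "\<And>\<xi>. norm \<xi> \<le> 1 \<Longrightarrow> \<bar>poly q (\<xi> \<bullet> b)\<bar> \<le> K"
proof -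
  have "compact ((\<lambda>\<xi>. poly q (\<xi> \<bullet> b)) ` cball 0 1)"
    by (intro compact_continuous_image continuous_intros) auto
  then have "bounded ((\<lambda>\<xi>. poly q (\<xi> \<bullet> b)) ` cball 0 1)" by (rule compact_imp_bounded)
  then obtain K where "\<forall>y\<in>(\<lambda>\<xi>. poly q (\<xi> \<bullet> b)) ` cball 0 1. norm y \<le> K"
    unfolding bounded_iff by blast
  then show thesis using that[of K] by auto
qed

lemma poly_bochner_riesz_bounded:
  fixes q :: "real poly" and b :: "'a::euclidean_space"
  assumes "M > 0"
  obtains K where "\<And>\<xi>. \<bar>poly q (\<xi> \<bullet> b) * bochner_riesz M \<xi>\<bar> \<le> K"
proof -
  obtain K where K: "\<And>\<xi>. norm \<xi> \<le> 1 \<Longrightarrow> \<bar>poly q (\<xi> \<bullet> b)\<bar> \<le> K"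
    using bounded_poly_inner[of q b] by blast
  have K0: "K \<ge> 0" using K[of 0] by simp
  have "\<bar>poly q (\<xi> \<bullet> b) * bochner_riesz M \<xi>\<bar> \<le> K" for \<xi>
  proof (cases "norm \<xi> \<le> 1")
    case True
    then show ?thesis
      using mult_mono[OF K[OF True] bochner_riesz_bounds(2)[of M \<xi>] K0 bochner_riesz_bounds(1)]
        bochner_riesz_bounds(1)[of M \<xi>] by (simp add: abs_mult)
  qed (use K0 assms in \<open>simp add: bochner_riesz_eq_0\<close>)
  then show thesis using that by blast
qed

lemma integrable_poly_bochner_riesz:
  fixes q :: "real poly"
  assumes "M > 0"
  shows "integrable lborel (\<lambda>\<xi>::'a::euclidean_space. poly q (\<xi> \<bullet> b) * bochner_riesz M \<xi>)"
proof -
  have meas: "(\<lambda>\<xi>. poly q (\<xi> \<bullet> b) * bochner_riesz M \<xi>) \<in> borel_measurable borel"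
    by (intro borel_measurable_times borel_measurable_bochner_riesz borel_measurable_continuous_onI continuous_intros)
  obtain K where K: "\<And>\<xi>. \<bar>poly q (\<xi> \<bullet> b) * bochner_riesz M \<xi>\<bar> \<le> K"
    using poly_bochner_riesz_bounded[OF assms, of q b] by blast
  show ?thesis
  proof (rule Bochner_Integration.integrable_bound)
    show "integrable lborel (\<lambda>\<xi>::'a. K * indicator (cball 0 1) \<xi>)"
      using emeasure_lborel_cball_finite[of "0::'a" 1] by (intro integrable_mult_right integrable_real_indicator) auto
    have supp: "bochner_riesz M \<xi> = 0" if "1 \<le> norm \<xi>" for \<xi> :: 'a
      using that assms by (simp add: bochner_riesz_eq_0)
    have "K \<ge> 0" using K[of 0] by linarith
    then show "AE \<xi> in lborel. norm (poly q (\<xi> \<bullet> b) * bochner_riesz M \<xi>) \<le> norm (K * indicator (cball 0 1) \<xi>)"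
      using K supp by (intro AE_I2) (auto simp: indicator_def not_le)
  qed (use meas in simp)
qed

text \<open>Each derivative along b yields one factor x . b. It lowers the order by at most one and
  produces a linear factor in \<xi> . b, so the induction has to run over all polynomial factors q
  and all orders. L < M ensures that the order is at least 2 whenever a derivative is taken.\<close>

lemma ift_bochner_riesz_decay_direction:
  fixes b :: "'a::euclidean_space" and q :: "real poly"
  assumes b: "norm b = 1" and M: "L < M"
  shows "\<exists>C. \<forall>x. \<bar>x \<bullet> b\<bar> ^ L * cmod (ift (\<lambda>\<xi>. of_real (poly q (\<xi> \<bullet> b) * bochner_riesz M \<xi>)) x) \<le> C"
  using M
proof (induction L arbitrary: q M)
  case 0
  show ?case by (intro exI allI, unfold power_0 mult_1, rule cmod_ift_le)
next
  case (Suc L)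
  define M' where "M' = M - 2"
  have M': "M = Suc (Suc M')" using Suc.prems by (simp add: M'_def)
  \<comment> \<open>The factor -2M (\<xi> . b) from the chain rule, joined to q; it accompanies the
    mean of order M - 1.\<close>
  define q2 where "q2 = [:0, - 2 * real M:] * q"
  let ?H = "\<lambda>q M \<xi>. poly q (\<xi> \<bullet> b) * bochner_riesz M \<xi>"
  let ?I = "\<lambda>q M. ift (\<lambda>\<xi>. complex_of_real (?H q M \<xi>))"
  obtain C1 where C1: "\<And>x. \<bar>x \<bullet> b\<bar> ^ L * cmod (?I (pderiv q) M x) \<le> C1"
    using Suc.IH[of M "pderiv q"] Suc.prems by auto
  obtain C2 where C2: "\<And>x. \<bar>x \<bullet> b\<bar> ^ L * cmod (?I q2 (Suc M') x) \<le> C2"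
    using Suc.IH[of "Suc M'" q2] Suc.prems M' by auto
  obtain K1 where K1: "\<And>\<xi>. \<bar>?H (pderiv q) M \<xi>\<bar> \<le> K1"
    using poly_bochner_riesz_bounded[of M "pderiv q" b] M' by blast
  obtain K2 where K2: "\<And>\<xi>. \<bar>?H q2 (Suc M') \<xi>\<bar> \<le> K2"
    using poly_bochner_riesz_bounded[of "Suc M'" q2 b] by blast
  let ?h' = "\<lambda>\<xi>. ?H (pderiv q) M \<xi> + ?H q2 (Suc M') \<xi>"
  have int: "integrable lborel (?H q M)" for q using M' by (intro integrable_poly_bochner_riesz) simp
  have int': "integrable lborel (?H q (Suc M'))" for q by (intro integrable_poly_bochner_riesz) simp
  have eq: "- \<i> * of_real (x \<bullet> b) * ?I q M x = ?I (pderiv q) M x + ?I q2 (Suc M') x" for x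
  proof -
    have "ift (\<lambda>\<xi>. of_real (?h' \<xi>)) x = - \<i> * of_real (x \<bullet> b) * ?I q M x"
    proof (rule ift_directional_derivative[where K = "K1 + K2" and R = 1, OF _ _ _ b])
      fix \<xi> s
      have "((\<lambda>s. (\<xi> + s *\<^sub>R b) \<bullet> b) has_real_derivative b \<bullet> b) (at s)"
        by (auto intro!: derivative_eq_intros simp: inner_add_left)
      from DERIV_chain2[OF poly_DERIV[of q] this] b
      have "((\<lambda>s. poly q ((\<xi> + s *\<^sub>R b) \<bullet> b)) has_real_derivative poly (pderiv q) ((\<xi> + s *\<^sub>R b) \<bullet> b)) (at s)"
        by (simp flip: power2_norm_eq_inner)
      from DERIV_mult[OF this DERIV_bochner_riesz[of M']]
      show "((\<lambda>s. ?H q M (\<xi> + s *\<^sub>R b)) has_real_derivative ?h' (\<xi> + s *\<^sub>R b)) (at s)"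
        by (simp add: M' q2_def algebra_simps)
    next
      show "\<bar>?h' \<xi>\<bar> \<le> K1 + K2" for \<xi> using K1[of \<xi>] K2[of \<xi>] by linarith
      show "1 \<le> norm \<xi> \<Longrightarrow> ?H q M \<xi> = 0" for \<xi> using M' by (simp add: bochner_riesz_eq_0)
      show "?h' \<in> borel_measurable borel"
        using int[of "pderiv q"] int'[of q2] by (auto dest!: borel_measurable_integrable)
    qed (rule int)
    moreover have "ift (\<lambda>\<xi>. of_real (?h' \<xi>)) x = ?I (pderiv q) M x + ?I q2 (Suc M') x"
      unfolding of_real_add by (rule ift_add; intro integrable_of_real int int')
    ultimately show ?thesis by simp
  qed
  have "\<bar>x \<bullet> b\<bar> * cmod (?I q M x) = cmod (?I (pderiv q) M x + ?I q2 (Suc M') x)" for x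
    using arg_cong[OF eq[of x], of cmod]
    unfolding norm_mult norm_minus_cancel norm_ii norm_of_real mult_1_left .
  then have "\<bar>x \<bullet> b\<bar> ^ Suc L * cmod (?I q M x) \<le> C1 + C2" for x
  proof -
    have "\<bar>x \<bullet> b\<bar> ^ Suc L * cmod (?I q M x) = \<bar>x \<bullet> b\<bar> ^ L * (\<bar>x \<bullet> b\<bar> * cmod (?I q M x))" by simp
    also have "\<dots> = \<bar>x \<bullet> b\<bar> ^ L * cmod (?I (pderiv q) M x + ?I q2 (Suc M') x)"
      by (simp only: \<open>\<And>x. \<bar>x \<bullet> b\<bar> * cmod (?I q M x) = cmod (?I (pderiv q) M x + ?I q2 (Suc M') x)\<close>)
    also have "\<dots> \<le> \<bar>x \<bullet> b\<bar> ^ L * (cmod (?I (pderiv q) M x) + cmod (?I q2 (Suc M') x))"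
      by (intro mult_left_mono norm_triangle_ineq) auto
    also have "\<dots> \<le> C1 + C2" using C1[of x] C2[of x] unfolding distrib_left by linarith
    finally show ?thesis .
  qed
  then show ?case by blast
qed

text \<open>Some coordinate satisfies |x| <= n |x . b|, so decay of order n + 1 in every coordinate
  direction is decay of order n + 1 in |x|, which is integrable.\<close>

lemma integrable_ift_bochner_riesz:
  fixes M :: nat
  assumes M: "Suc DIM('a::euclidean_space) < M"
  shows "integrable lborel (ift (\<lambda>\<xi>::'a. of_real (bochner_riesz M \<xi>)))"
proof -
  let ?n = "DIM('a)" and ?k = "ift (\<lambda>\<xi>::'a. complex_of_real (bochner_riesz M \<xi>))"
  have "\<exists>C. \<forall>x. \<bar>x \<bullet> b\<bar> ^ Suc ?n * cmod (?k x) \<le> C" if "b \<in> Basis" for b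
    using ift_bochner_riesz_decay_direction[of b "Suc ?n" M 1] that M by simp
  then obtain C where C: "\<And>b x. b \<in> Basis \<Longrightarrow> \<bar>x \<bullet> b\<bar> ^ Suc ?n * cmod (?k x) \<le> C b"
    by metis
  have n1: "1 \<le> real ?n" by (simp add: Suc_le_eq)
  obtain C0 where C0: "\<And>x. cmod (?k x) \<le> C0" using cmod_ift_le by blast
  define A where "A = C0 + (\<Sum>b\<in>Basis. C b)"
  have Cpos: "C b \<ge> 0" if "b \<in> Basis" for b
    using order_trans[OF _ C[OF that, of 0]] by simp
  have C0pos: "C0 \<ge> 0" using order_trans[OF _ C0[of 0]] by simp
  \<comment> \<open>The factor (1 + n) n serves both ranges: for |x| <= 1 it dominates 1 + |x|, and
    for |x| > 1 it gives 1 + |x| <= (1 + n) n |x . b| for a suitable b.\<close>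
  have decay: "(1 + norm x) ^ Suc ?n * cmod (?k x) \<le> ((1 + real ?n) * real ?n) ^ Suc ?n * A" for x
  proof (cases "norm x \<le> 1")
    case True
    have "cmod (?k x) \<le> A" using C0[of x] sum_nonneg[of Basis C] Cpos by (simp add: A_def)
    moreover have "(1 + norm x) ^ Suc ?n \<le> ((1 + real ?n) * real ?n) ^ Suc ?n"
    proof (rule power_mono)
      have "1 + norm x \<le> (1 + real ?n) * 1"
        unfolding mult_1_right by (rule add_left_mono[OF order_trans[OF True n1]])
      also have "\<dots> \<le> (1 + real ?n) * real ?n"
        using n1 by (intro mult_left_mono) auto
      finally show "1 + norm x \<le> (1 + real ?n) * real ?n" .
    qed simp
    ultimately show ?thesis by (intro mult_mono) auto
  next
    case False
    have "\<exists>b\<in>Basis. norm x \<le> real ?n * \<bar>x \<bullet> b\<bar>"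
    proof (rule ccontr)
      assume "\<not> ?thesis"
      then have "\<And>b. b \<in> Basis \<Longrightarrow> real ?n * \<bar>x \<bullet> b\<bar> < norm x" by auto
      then have "(\<Sum>b\<in>Basis. real ?n * \<bar>x \<bullet> b\<bar>) < (\<Sum>b\<in>(Basis::'a set). norm x)"
        by (intro sum_strict_mono) auto
      then have "real ?n * (\<Sum>b\<in>Basis. \<bar>x \<bullet> b\<bar>) < real ?n * norm x"
        by (simp add: sum_distrib_left)
      then show False using norm_le_l1[of x] by (simp add: mult_less_cancel_left_disj)
    qed
    then obtain b where b: "b \<in> Basis" "norm x \<le> real ?n * \<bar>x \<bullet> b\<bar>" by blast
    have xb: "1 \<le> real ?n * \<bar>x \<bullet> b\<bar>" using b False by simp
    have "1 + norm x \<le> (1 + real ?n) * (real ?n * \<bar>x \<bullet> b\<bar>)"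
    proof -
      have "1 * (real ?n * \<bar>x \<bullet> b\<bar>) \<le> real ?n * (real ?n * \<bar>x \<bullet> b\<bar>)"
        using n1 by (intro mult_right_mono) auto
      then show ?thesis using b xb unfolding distrib_right mult_1_left by linarith
    qed
    then have "1 + norm x \<le> ((1 + real ?n) * real ?n) * \<bar>x \<bullet> b\<bar>" by (simp add: mult_ac)
    then have "(1 + norm x) ^ Suc ?n * cmod (?k x) \<le> (((1 + real ?n) * real ?n) * \<bar>x \<bullet> b\<bar>) ^ Suc ?n * cmod (?k x)"
      by (intro mult_right_mono power_mono) auto
    also have "\<dots> = ((1 + real ?n) * real ?n) ^ Suc ?n * (\<bar>x \<bullet> b\<bar> ^ Suc ?n * cmod (?k x))"
      by (simp only: power_mult_distrib mult.assoc)
    also have "\<dots> \<le> ((1 + real ?n) * real ?n) ^ Suc ?n * A"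
    proof (rule mult_left_mono)
      have "C b \<le> (\<Sum>b\<in>Basis. C b)" using Cpos b by (intro member_le_sum) auto
      then show "\<bar>x \<bullet> b\<bar> ^ Suc ?n * cmod (?k x) \<le> A"
        using C[OF b(1), of x] C0pos by (simp add: A_def)
    qed simp
    finally show ?thesis .
  qed
  have int: "integrable lborel (\<lambda>\<xi>::'a. complex_of_real (bochner_riesz M \<xi>))"
    using integrable_poly_bochner_riesz[of M 1 0] M by (intro integrable_of_real) simp
  show ?thesis
  proof (rule Bochner_Integration.integrable_bound)
    show "integrable lborel (\<lambda>x::'a. ((1 + real ?n) * real ?n) ^ Suc ?n * A * (1 / (1 + norm x) ^ Suc ?n))"
      by (intro integrable_mult_right integrable_decay_weight)
    show "AE x in lborel. norm (?k x) \<le> norm (((1 + real ?n) * real ?n) ^ Suc ?n * A * (1 / (1 + norm x) ^ Suc ?n))"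
    proof (rule AE_I2)
      fix x :: 'a
      have "0 < (1 + norm x) ^ Suc ?n" by (simp add: add_pos_nonneg)
      then have "norm (?k x) \<le> ((1 + real ?n) * real ?n) ^ Suc ?n * A * (1 / (1 + norm x) ^ Suc ?n)"
        using decay[of x] by (simp add: pos_le_divide_eq mult.commute del: power_Suc)
      then show "norm (?k x) \<le> norm (((1 + real ?n) * real ?n) ^ Suc ?n * A * (1 / (1 + norm x) ^ Suc ?n))"
        unfolding real_norm_def by (rule order_trans) (rule abs_ge_self)
    qed
    show "?k \<in> borel_measurable lborel" using borel_measurable_ift[OF int] by simp
  qed
qed

section \<open>Integrability of the kernels\<close>

text \<open>The linear span of s^c exp(-s^b) with c > 0. It is stable under the Euler derivative s
  d/ds and under multiplication by nonnegative powers; c > 0 makes its members integrable against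
  ds/s at the origin.\<close>

inductive_set exp_span :: "real \<Rightarrow> (real \<Rightarrow> real) set" for b where
  base: "c > 0 \<Longrightarrow> (\<lambda>s. s powr c * exp (- (s powr b))) \<in> exp_span b"
| add: "g \<in> exp_span b \<Longrightarrow> h \<in> exp_span b \<Longrightarrow> (\<lambda>s. g s + h s) \<in> exp_span b"
| scale: "g \<in> exp_span b \<Longrightarrow> (\<lambda>s. a * g s) \<in> exp_span b"

lemma exp_span_measurable: "g \<in> exp_span b \<Longrightarrow> g \<in> borel_measurable borel"
  by (induction rule: exp_span.induct) (auto intro: borel_measurable_times)

lemma exp_span_powr:
  assumes "g \<in> exp_span b" "0 \<le> d"
  shows "(\<lambda>s. s powr d * g s) \<in> exp_span b"
  using assms(1)
proof (induction rule: exp_span.induct)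
  case (base c)
  have "(\<lambda>s. s powr d * (s powr c * exp (- (s powr b)))) = (\<lambda>s. s powr (d + c) * exp (- (s powr b)))"
    by (simp add: powr_add mult.assoc)
  then show ?case using exp_span.base[of "d + c" b] base assms(2) by simp
next
  case (add g h)
  then show ?case using exp_span.add[OF add.IH] by (simp add: distrib_left)
next
  case (scale g a)
  then show ?case using exp_span.scale[OF scale.IH, of a] by (simp add: mult.left_commute)
qed

lemma DERIV_powr_exp:
  assumes "s > 0"
  shows "((\<lambda>s. s powr c * exp (- (s powr b))) has_real_derivative
    (c * (s powr c * exp (- (s powr b))) + - b * (s powr (c + b) * exp (- (s powr b)))) / s) (at s)"
  using assms
  by (auto intro!: derivative_eq_intros simp: powr_diff powr_add field_simps)

lemma exp_span_deriv:
  assumes "g \<in> exp_span b" "b > 0"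
  shows "\<exists>h\<in>exp_span b. \<forall>s>0. (g has_real_derivative h s / s) (at s)"
  using assms(1)
proof (induction rule: exp_span.induct)
  case (base c)
  have "(\<lambda>s. c * (s powr c * exp (- (s powr b))) + - b * (s powr (c + b) * exp (- (s powr b)))) \<in> exp_span b"
    using base assms(2) by (intro exp_span.intros) auto
  then show ?case by (rule bexI[rotated]) (intro allI impI DERIV_powr_exp)
next
  case (add g h)
  then obtain g' h' where *: "g' \<in> exp_span b" "h' \<in> exp_span b" and
    "\<And>s. s > 0 \<Longrightarrow> (g has_real_derivative g' s / s) (at s)"
    "\<And>s. s > 0 \<Longrightarrow> (h has_real_derivative h' s / s) (at s)" by blast
  then show ?case
    by (intro bexI[OF _ exp_span.add[OF *]]) (auto simp: add_divide_distrib intro!: DERIV_add)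
next
  case (scale g a)
  then obtain g' where *: "g' \<in> exp_span b" and "\<And>s. s > 0 \<Longrightarrow> (g has_real_derivative g' s / s) (at s)" by blast
  then show ?case
    using DERIV_cmult[of g _ _ UNIV a]
    by (intro bexI[OF _ exp_span.scale[OF *, of a]]) (simp flip: times_divide_eq_right)
qed

lemma tendsto_powr_exp:
  assumes "b > 0"
  shows "((\<lambda>s::real. s powr c * exp (- (s powr b))) \<longlongrightarrow> 0) at_top"
  using assms by real_asymp

lemma exp_span_tendsto:
  assumes "g \<in> exp_span b" "b > 0"
  shows "(g \<longlongrightarrow> 0) at_top"
  using assms(1)
proof (induction rule: exp_span.induct)
  case (base c)
  then show ?case using tendsto_powr_exp[OF assms(2)] by simp
next
  case (add g h)
  then show ?case using tendsto_add[OF add.IH] by simp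
next
  case (scale g a)
  then show ?case using tendsto_mult_left[OF scale.IH, of a] by simp
qed

lemma set_integrable_lborel_nonneg:
  fixes f :: "real \<Rightarrow> real"
  assumes "f integrable_on S" "\<And>x. x \<in> S \<Longrightarrow> 0 \<le> f x" "f \<in> borel_measurable borel" "S \<in> sets borel"
  shows "set_integrable lborel S f"
proof -
  have "set_integrable lebesgue S f"
    using assms(1,2) by (rule nonnegative_absolutely_integrable_1)
  moreover note assms(3,4)[measurable]
  ultimately show ?thesis
    unfolding set_integrable_def by (subst (asm) integrable_completion) simp_all
qed

text \<open>Near 0 a generator divided by s is at most s^(c-1), integrable since c > 0; for large s
  the exponential beats s^(c+1) and leaves s^(-2).\<close>

lemma exp_span_integrable:
  assumes "g \<in> exp_span b" "b > 0"
  shows "set_integrable lborel {0<..} (\<lambda>s. g s / s)"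
  using assms(1)
proof (induction rule: exp_span.induct)
  case (base c)
  have "\<forall>\<^sub>F s::real in at_top. s powr (c + 1) * exp (- (s powr b)) < 1"
    using tendsto_powr_exp[OF assms(2)] by (rule order_tendstoD) simp
  then obtain S0 where S0: "\<And>s. s \<ge> S0 \<Longrightarrow> s powr (c + 1) * exp (- (s powr b)) < 1"
    by (auto simp: eventually_at_top_linorder)
  define S where "S = max 1 S0"
  have S: "S \<ge> 1" "\<And>s. s \<ge> S \<Longrightarrow> s powr (c + 1) * exp (- (s powr b)) < 1"
    using S0 by (auto simp: S_def)
  have 1: "set_integrable lborel {0..S} (\<lambda>s. s powr (c - 1))"
    using base S by (intro set_integrable_lborel_nonneg integrable_on_powr_from_0) auto
  have 2: "set_integrable lborel {S..} (\<lambda>s. s powr (-2))"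
    using S has_integral_powr_to_inf[of "-2" S]
    by (intro set_integrable_lborel_nonneg) (auto simp: integrable_on_def)
  have "integrable lborel (\<lambda>s. indicator {0..S} s *\<^sub>R s powr (c - 1) + indicator {S..} s *\<^sub>R s powr (-2))"
    using 1 2 unfolding set_integrable_def by (rule Bochner_Integration.integrable_add)
  then show ?case
    unfolding set_integrable_def
  proof (rule Bochner_Integration.integrable_bound)
    show "AE s in lborel. norm (indicator {0<..} s *\<^sub>R (s powr c * exp (- (s powr b)) / s))
        \<le> norm (indicator {0..S} s *\<^sub>R s powr (c - 1) + indicator {S..} s *\<^sub>R s powr (-2))"
    proof (rule AE_I2)
      fix s :: real
      consider "s \<le> 0" | "0 < s" "s < S" | "S \<le> s" using S by linarith
      then show "norm (indicator {0<..} s *\<^sub>R (s powr c * exp (- (s powr b)) / s))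
        \<le> norm (indicator {0..S} s *\<^sub>R s powr (c - 1) + indicator {S..} s *\<^sub>R s powr (-2))"
      proof cases
        case 2
        have "s powr c * exp (- (s powr b)) \<le> s powr c * 1" by (intro mult_left_mono) auto
        then show ?thesis using 2 by (simp add: powr_diff divide_right_mono)
      next
        case 3
        then have s: "s > 0" using S by simp
        have "s powr c * exp (- (s powr b)) / s = s powr (c + 1) * exp (- (s powr b)) * s powr (-2)"
          using s by (simp add: powr_diff powr_add powr_minus_divide power2_eq_square)
        also have "\<dots> \<le> 1 * s powr (-2)"
          using S(2)[OF 3] by (intro mult_right_mono) auto
        finally have "s powr c * exp (- (s powr b)) / s \<le> s powr (-2)" by simp
        moreover have "0 \<le> indicator {0..S} s *\<^sub>R s powr (c - 1)" by simp
        ultimately show ?thesis using 3 s by (simp add: add_increasing)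
      qed auto
    qed
  qed measurable
next
  case (add g h)
  then show ?case using set_integral_add(1)[OF add.IH] by (simp add: add_divide_distrib)
next
  case (scale g a)
  then show ?case using set_integrable_mult_right[OF scale.IH, of a] by simp
qed

text \<open>\<open>T u N s\<close> is the Taylor polynomial of \<open>f\<close> at s, evaluated at
  u. Its derivative in s telescopes to a single term, it equals f u at s = u, and it tends to 0 as s
  grows; so f u is minus the integral of that term over (u, \<infinity>). The factor (u - s)^N
  divided by s^N is, up to sign, the truncated power.\<close>

lemma taylor_at_top:
  fixes f :: "real \<Rightarrow> real"
  assumes b: "b > 0" and g: "g \<in> exp_span b" and N: "N > 0"
    and deriv: "\<And>s. s > 0 \<Longrightarrow> (f has_real_derivative g s / s) (at s)"
    and lim: "(f \<longlongrightarrow> 0) at_top"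
  obtains w where "w \<in> exp_span b"
    "\<And>u. u > 0 \<Longrightarrow> f u = (LBINT s:{0<..}. max 0 (1 - u / s) ^ N * (w s / s))"
proof -
  \<comment> \<open>For s > 0, G n s is s^(n+1) times the derivative of order n + 1 of f. This
    weight keeps every G n in \<open>exp_span\<close>, by the recursion: G (n+1) is the Euler
    derivative of G n minus (n+1) G n.\<close>
  have "\<exists>G. \<forall>n. (G n \<in> exp_span b \<and> (n = 0 \<longrightarrow> G n = g)) \<and>
      (\<forall>s>0. ((\<lambda>s. G n s / s ^ Suc n) has_real_derivative G (Suc n) s / s ^ Suc (Suc n)) (at s))"
  proof (rule dependent_nat_choice)
    fix x :: "real \<Rightarrow> real" and n :: nat
    assume "x \<in> exp_span b \<and> (n = 0 \<longrightarrow> x = g)"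
    then have x: "x \<in> exp_span b" by simp
    then obtain h where h: "h \<in> exp_span b" "\<And>s. s > 0 \<Longrightarrow> (x has_real_derivative h s / s) (at s)"
      using exp_span_deriv[OF _ b] by blast
    show "\<exists>y. (y \<in> exp_span b \<and> (Suc n = 0 \<longrightarrow> y = g)) \<and>
        (\<forall>s>0. ((\<lambda>s. x s / s ^ Suc n) has_real_derivative y s / s ^ Suc (Suc n)) (at s))"
    proof (intro exI[of _ "\<lambda>s. h s + - real (Suc n) * x s"] conjI allI impI)
      show "(\<lambda>s. h s + - real (Suc n) * x s) \<in> exp_span b"
        by (intro exp_span.intros h x)
      fix s :: real assume s: "s > 0"
      show "((\<lambda>s. x s / s ^ Suc n) has_real_derivative (h s + - real (Suc n) * x s) / s ^ Suc (Suc n)) (at s)"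
        by (rule DERIV_cong, rule DERIV_divide[OF h(2)[OF s] DERIV_pow]) (use s in \<open>auto simp: field_simps\<close>)
    qed simp
  qed (use g in auto)
  then obtain G where G: "\<And>n. G n \<in> exp_span b" "G 0 = g"
    "\<And>n s. s > 0 \<Longrightarrow> ((\<lambda>s. G n s / s ^ Suc n) has_real_derivative G (Suc n) s / s ^ Suc (Suc n)) (at s)"
    by metis
  define T where "T u N s = f s + (\<Sum>j<N. (u - s) ^ Suc j / fact (Suc j) * (G j s / s ^ Suc j))" for u N s
  have T': "(T u N has_real_derivative (u - s) ^ N / fact N * (G N s / s ^ Suc N)) (at s)" if "s > 0" for u s N
  proof (induction N)
    case 0
    show ?case using deriv[OF that] by (simp add: T_def G)
  next
    case (Suc N)
    have "((\<lambda>s. (u - s) ^ Suc N / fact (Suc N) * (G N s / s ^ Suc N)) has_real_derivative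
      (u - s) ^ Suc N / fact (Suc N) * (G (Suc N) s / s ^ Suc (Suc N))
        - (u - s) ^ N / fact N * (G N s / s ^ Suc N)) (at s)"
      by (rule derivative_eq_intros G(3) that refl | simp)+
        (simp add: field_simps del: of_nat_Suc)
    from DERIV_add[OF Suc.IH this]
    have "((\<lambda>s. T u N s + (u - s) ^ Suc N / fact (Suc N) * (G N s / s ^ Suc N)) has_real_derivative
      (u - s) ^ Suc N / fact (Suc N) * (G (Suc N) s / s ^ Suc (Suc N))) (at s)"
      by (rule DERIV_cong) (simp only: add_diff_cancel_left' add_diff_eq)
    moreover have "T u (Suc N) = (\<lambda>s. T u N s + (u - s) ^ Suc N / fact (Suc N) * (G N s / s ^ Suc N))"
      unfolding T_def by (simp only: sum.lessThan_Suc add.assoc)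
    ultimately show ?case by (simp only:)
  qed
  have T_lim: "(T u N \<longlongrightarrow> 0) at_top" for u N
  proof -
    have "((\<lambda>s. (u - s) ^ Suc j / fact (Suc j) * (G j s / s ^ Suc j)) \<longlongrightarrow> 0) at_top" for j
    proof (rule Lim_transform_eventually)
      have "((\<lambda>s. u / s - 1) \<longlongrightarrow> -1) at_top" by real_asymp
      then have "((\<lambda>s. (u / s - 1) ^ Suc j / fact (Suc j) * G j s) \<longlongrightarrow> (-1) ^ Suc j / fact (Suc j) * 0) at_top"
        by (intro tendsto_mult tendsto_divide tendsto_power tendsto_const exp_span_tendsto[OF G(1) b]) (simp_all only: fact_nonzero not_False_eq_True)
      then show "((\<lambda>s. (u / s - 1) ^ Suc j / fact (Suc j) * G j s) \<longlongrightarrow> 0) at_top" by simp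
      show "\<forall>\<^sub>F s in at_top. (u / s - 1) ^ Suc j / fact (Suc j) * G j s = (u - s) ^ Suc j / fact (Suc j) * (G j s / s ^ Suc j)"
        using eventually_gt_at_top[of 0]
      proof eventually_elim
        case (elim s)
        then have "u / s - 1 = (u - s) / s" by (simp add: field_simps)
        then show ?case by (simp only: power_divide) simp
      qed
    qed
    then have "((\<lambda>s. f s + (\<Sum>j<N. (u - s) ^ Suc j / fact (Suc j) * (G j s / s ^ Suc j))) \<longlongrightarrow> 0 + (\<Sum>j<N. 0)) at_top"
      by (intro tendsto_add tendsto_sum lim)
    then show ?thesis by (simp add: T_def[abs_def])
  qed
  \<comment> \<open>One sign comes from (u - s)^N = (-1)^N (s - u)^N, the other from integrating a
    derivative towards the limit 0.\<close>
  define w where "w s = (- 1) ^ Suc N / fact N * G N s" for s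
  have "f u = (LBINT s:{0<..}. max 0 (1 - u / s) ^ N * (w s / s))" if u: "u > 0" for u
  proof -
    define h where "h s = (u - s) ^ N / fact N * (G N s / s ^ Suc N)" for s
    have [measurable]: "G N \<in> borel_measurable borel" by (rule exp_span_measurable[OF G(1)])
    have h_int: "set_integrable lborel {u<..} h"
    proof -
      have "set_integrable lborel {u<..} (\<lambda>s. G N s / s)"
        by (rule set_integrable_subset[OF exp_span_integrable[OF G(1) b]]) (use u in auto)
      then show ?thesis unfolding set_integrable_def
      proof (rule Bochner_Integration.integrable_bound)
        show "(\<lambda>s. indicator {u<..} s *\<^sub>R h s) \<in> borel_measurable lborel"
          unfolding h_def by measurable
        show "AE s in lborel. norm (indicator {u<..} s *\<^sub>R h s) \<le> norm (indicator {u<..} s *\<^sub>R (G N s / s))"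
        proof (rule AE_I2)
          fix s
          show "norm (indicator {u<..} s *\<^sub>R h s) \<le> norm (indicator {u<..} s *\<^sub>R (G N s / s))"
          proof (cases "u < s")
            case True
            have "\<bar>(u - s) ^ N / s ^ N\<bar> / fact N \<le> 1 / 1"
            proof (rule frac_le)
              have "\<bar>(u - s) / s\<bar> ^ N \<le> 1"
                using True u by (intro power_le_one) (auto simp: field_simps)
              then show "\<bar>(u - s) ^ N / s ^ N\<bar> \<le> 1" by (simp add: power_abs power_divide)
            qed auto
            then have "\<bar>(u - s) ^ N / s ^ N\<bar> / fact N * \<bar>G N s / s\<bar> \<le> 1 * \<bar>G N s / s\<bar>"
              by (intro mult_right_mono) auto
            moreover have "\<bar>h s\<bar> = \<bar>(u - s) ^ N / s ^ N\<bar> / fact N * \<bar>G N s / s\<bar>"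
              by (simp add: h_def abs_mult)
            ultimately show ?thesis using True by simp
          qed simp
        qed
      qed
    qed
    have "(LBINT s=ereal u..\<infinity>. h s) = 0 - T u N u"
    proof (rule interval_integral_FTC_integrable)
      show "(T u N has_vector_derivative h s) (at s)" if "ereal u < ereal s" "ereal s < \<infinity>" for s
        using T'[of s u N] that u by (simp add: h_def has_real_derivative_iff_has_vector_derivative)
      show "isCont h s" if "ereal u < ereal s" "ereal s < \<infinity>" for s
        unfolding h_def using that u
        by (intro continuous_mult DERIV_isCont[OF G(3)] continuous_divide continuous_intros) auto
      show "set_integrable lborel (einterval (ereal u) \<infinity>) h" using h_int by simp
      have "isCont (T u N) u" using T'[OF u] by (rule DERIV_isCont)
      then have "(T u N \<longlongrightarrow> T u N u) (at_right u)"
        by (auto simp: isCont_def intro: tendsto_mono[OF at_le])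
      then show "((T u N \<circ> real_of_ereal) \<longlongrightarrow> T u N u) (at_right (ereal u))"
        by (simp add: ereal_tendsto_simps)
      show "((T u N \<circ> real_of_ereal) \<longlongrightarrow> 0) (at_left \<infinity>)"
        using T_lim by (simp add: ereal_tendsto_simps)
    qed simp
    moreover have "T u N u = f u" by (simp add: T_def)
    ultimately have "f u = - (LBINT s:{u<..}. h s)"
      by (simp add: interval_integral_to_infinity_eq)
    also have "\<dots> = (LBINT s:{u<..}. - h s)"
      by (simp add: set_lebesgue_integral_def)
    also have "\<dots> = (LBINT s:{0<..}. max 0 (1 - u / s) ^ N * (w s / s))"
      unfolding set_lebesgue_integral_def
    proof (rule Bochner_Integration.integral_cong[OF refl])
      fix s :: real
      show "indicator {u<..} s *\<^sub>R - h s = indicator {0<..} s *\<^sub>R (max 0 (1 - u / s) ^ N * (w s / s))"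
      proof (cases "u < s")
        case True
        then have s: "s > 0" using u by simp
        have "max 0 (1 - u / s) = (s - u) / s" using True s by (simp add: field_simps max_def)
        moreover have "(u - s) ^ N = (-1) ^ N * (s - u) ^ N"
          by (metis minus_diff_eq mult_minus1 power_mult_distrib)
        ultimately show ?thesis using True s by (simp add: h_def w_def power_divide mult_ac)
      next
        case False
        then show ?thesis using N by (cases "s > 0") (auto simp: max_def field_simps)
      qed
    qed
    finally show ?thesis .
  qed
  moreover have "w \<in> exp_span b"
    unfolding w_def[abs_def] by (intro exp_span.scale G)
  ultimately show thesis using that by blast
qed

text \<open>For a = 0 the function itself lies outside \<open>exp_span\<close>, but its Euler
  derivative lies inside, since the term with exponent 0 drops out. This is why
  \<open>taylor_at_top\<close> asks for membership of the derivative only.\<close>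

lemma powr_exp_superposition:
  assumes a: "a \<ge> 0" and b: "b > 0" and N: "N > 0"
  obtains w where "w \<in> exp_span b"
    "\<And>u. u > 0 \<Longrightarrow> u powr a * exp (- (u powr b)) = (LBINT s:{0<..}. max 0 (1 - u / s) ^ N * (w s / s))"
proof -
  let ?g = "\<lambda>s. a * (s powr a * exp (- (s powr b))) + - b * (s powr (a + b) * exp (- (s powr b)))"
  have "(\<lambda>s. - b * (s powr (a + b) * exp (- (s powr b)))) \<in> exp_span b"
    using a b by (intro exp_span.intros) auto
  moreover have "(\<lambda>s. a * (s powr a * exp (- (s powr b)))) \<in> exp_span b" if "a \<noteq> 0"
    using that a by (intro exp_span.intros) auto
  ultimately have g: "?g \<in> exp_span b"
    using exp_span.add by (cases "a = 0") (simp, blast)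
  show thesis
    using taylor_at_top[OF b g N DERIV_powr_exp tendsto_powr_exp[OF b]] that by blast
qed

text \<open>Since \<open>0 powr 0 = 0\<close>, for \<kappa> = 0 the value at the origin is 0 instead
  of 1. Comparisons with the true multiplier are therefore made off the origin, which is a null
  set.\<close>

definition symbol :: "real \<Rightarrow> real \<Rightarrow> real \<Rightarrow> 'a::euclidean_space \<Rightarrow> real" where
  "symbol \<kappa> \<alpha> t \<xi> = norm \<xi> powr \<kappa> * exp (- t * norm \<xi> powr (2 * \<alpha>))"

lemma borel_measurable_symbol [measurable]: "symbol \<kappa> \<alpha> t \<in> borel_measurable borel"
  unfolding symbol_def by measurable

text \<open>Taylor's formula at infinity in the variable \<open>u = \<bar>\<xi>\<bar>\<^sup>2\<close> writes the symbol as an integral of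
  dilated Bochner--Riesz means. Dilation preserves the \<open>L\<^sup>1\<close> norm of the inverse Fourier transform.\<close>

lemma integrable_symbol_one:
  assumes \<kappa>: "\<kappa> \<ge> 0" and \<alpha>: "\<alpha> > 0"
  shows "integrable lborel (symbol \<kappa> \<alpha> 1 :: 'a::euclidean_space \<Rightarrow> real)"
    and "integrable lborel (ift (\<lambda>\<xi>::'a. of_real (symbol \<kappa> \<alpha> 1 \<xi>)))"
proof -
  let ?n = "DIM('a)"
  define M where "M = Suc (Suc ?n)"
  define \<beta> :: "'a \<Rightarrow> real" where "\<beta> = bochner_riesz M"
  have M: "M > 0" by (simp add: M_def)
  have [measurable]: "\<beta> \<in> borel_measurable borel" by (simp add: \<beta>_def)
  have \<beta>_int: "integrable lborel \<beta>"
    using integrable_poly_bochner_riesz[OF M, of 1 "0::'a"] by (simp add: \<beta>_def)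
  have \<beta>_nonneg: "0 \<le> \<beta> \<xi>" for \<xi> by (simp add: \<beta>_def bochner_riesz_bounds)
  let ?K = "ift (\<lambda>\<xi>::'a. complex_of_real (\<beta> \<xi>))"
  have K_int: "integrable lborel ?K"
    unfolding \<beta>_def by (rule integrable_ift_bochner_riesz) (simp add: M_def)
  have [measurable]: "?K \<in> borel_measurable borel" using K_int by auto
  \<comment> \<open>The variable is u = |\<xi>|^2, hence the exponents \<kappa>/2 and
    \<alpha>.\<close>
  obtain w where w: "w \<in> exp_span \<alpha>" and w_eq: "\<And>u. u > 0 \<Longrightarrow>
      u powr (\<kappa> / 2) * exp (- (u powr \<alpha>)) = (LBINT s:{0<..}. max 0 (1 - u / s) ^ M * (w s / s))"
    using powr_exp_superposition[of "\<kappa> / 2" \<alpha> M] \<kappa> \<alpha> M by auto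
  have [measurable]: "w \<in> borel_measurable borel" by (rule exp_span_measurable[OF w])
  define v where "v s = indicator {0<..} s * (w s / s)" for s :: real
  have [measurable]: "v \<in> borel_measurable borel" unfolding v_def by measurable
  have v_int: "integrable lborel v"
    using exp_span_integrable[OF w \<alpha>] by (simp add: set_integrable_def v_def[abs_def])
  \<comment> \<open>Dilation by sqrt s multiplies the L^1 norm of the mean itself, as opposed to
    that of its transform, by s^(n/2). Fubini on the frequency side needs this weight to be
    integrable as well.\<close>
  have v_powr_int: "integrable lborel (\<lambda>s. sqrt s ^ ?n * v s)"
  proof -
    have "integrable lborel (\<lambda>s. indicator {0<..} s *\<^sub>R (s powr (real ?n / 2) * w s / s))"
      using exp_span_integrable[OF exp_span_powr[OF w, of "real ?n / 2"] \<alpha>] by (simp add: set_integrable_def)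
    also have "(\<lambda>s. indicator {0<..} s *\<^sub>R (s powr (real ?n / 2) * w s / s)) = (\<lambda>s. sqrt s ^ ?n * v s)"
    proof
      fix s :: real
      show "indicator {0<..} s *\<^sub>R (s powr (real ?n / 2) * w s / s) = sqrt s ^ ?n * v s"
      proof (cases "s > 0")
        case True
        then have "sqrt s ^ ?n = s powr (real ?n / 2)"
          by (simp add: powr_half_sqrt[symmetric] powr_powr flip: powr_realpow)
        then show ?thesis using True by (simp add: v_def)
      qed (simp add: v_def)
    qed
    finally show ?thesis .
  qed
  define H where "H = (\<lambda>s (\<xi>::'a). v s * \<beta> (\<xi> /\<^sub>R sqrt s))"
  have H_meas [measurable]: "(\<lambda>(s, \<xi>). H s \<xi>) \<in> borel_measurable (lborel \<Otimes>\<^sub>M lborel)"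
    unfolding H_def by measurable
  have \<beta>_dil_int: "integrable lborel (\<lambda>\<xi>. \<beta> (\<xi> /\<^sub>R sqrt s))" if "s > 0" for s
    using integrable_lborel_affine[OF \<beta>_int, of "inverse (sqrt s)" 0] that by simp
  have H_int_\<xi>: "integrable lborel (H s)" for s
    using \<beta>_dil_int[of s] by (cases "s > 0") (auto simp: H_def v_def)
  have H_norm: "(LBINT \<xi>. norm (H s \<xi>)) = \<bar>sqrt s ^ ?n * v s\<bar> * (LBINT \<xi>. \<beta> \<xi>)" for s
  proof (cases "s > 0")
    case True
    have "(LBINT \<xi>. \<beta> (\<xi> /\<^sub>R sqrt s)) = sqrt s ^ ?n * (LBINT \<xi>. \<beta> \<xi>)"
      using True integral_lborel_affine[of "sqrt s" "\<lambda>\<xi>. \<beta> (\<xi> /\<^sub>R sqrt s)" 0] by simp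
    then show ?thesis using True by (simp add: H_def abs_mult \<beta>_nonneg abs_of_nonneg)
  qed (simp add: H_def v_def)
  have H_int: "integrable (lborel \<Otimes>\<^sub>M lborel) (\<lambda>(s, \<xi>). H s \<xi>)"
  proof (rule lborel_pair.Fubini_integrable)
    show "integrable lborel (\<lambda>s. LBINT \<xi>. norm (case (s, \<xi>) of (s, \<xi>) \<Rightarrow> H s \<xi>))"
      using v_powr_int by (simp add: H_norm[simplified])
  qed (use H_int_\<xi> in auto)
  have symbol_eq: "symbol \<kappa> \<alpha> 1 \<xi> = (LBINT s. H s \<xi>)" if "\<xi> \<noteq> 0" for \<xi>
  proof -
    have pos: "(norm \<xi>)\<^sup>2 > 0" using that by simp
    have "symbol \<kappa> \<alpha> 1 \<xi> = ((norm \<xi>)\<^sup>2) powr (\<kappa> / 2) * exp (- (((norm \<xi>)\<^sup>2) powr \<alpha>))"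
      using that by (simp add: symbol_def powr_powr flip: powr_numeral)
    also have "\<dots> = (LBINT s. H s \<xi>)"
      unfolding w_eq[OF pos] set_lebesgue_integral_def
    proof (rule Bochner_Integration.integral_cong[OF refl])
      fix s :: real
      show "indicator {0<..} s *\<^sub>R (max 0 (1 - (norm \<xi>)\<^sup>2 / s) ^ M * (w s / s)) = H s \<xi>"
        by (cases "s > 0")
          (simp_all add: H_def v_def \<beta>_def bochner_riesz_def power_mult_distrib power_divide field_simps)
    qed
    finally show ?thesis .
  qed
  have AE_symbol: "AE \<xi>::'a in lborel. symbol \<kappa> \<alpha> 1 \<xi> = (LBINT s. H s \<xi>)"
    using AE_lborel_singleton[of "0::'a"] by eventually_elim (rule symbol_eq)
  have "integrable lborel (\<lambda>\<xi>. LBINT s. H s \<xi>)"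
    using lborel_pair.integrable_snd[OF H_int] by simp
  then show sym_int: "integrable lborel (symbol \<kappa> \<alpha> 1 :: 'a \<Rightarrow> real)"
    by (subst integrable_cong_AE[OF _ _ AE_symbol]) auto
  let ?S = "ift (\<lambda>\<xi>::'a. complex_of_real (symbol \<kappa> \<alpha> 1 \<xi>))"
  have ift_eq: "?S x = (LINT s|lborel. of_real (sqrt s ^ ?n * v s) * ?K (sqrt s *\<^sub>R x))" for x
  proof -
    have cH_int: "integrable (lborel \<Otimes>\<^sub>M lborel) (\<lambda>(s, \<xi>). cis (x \<bullet> \<xi>) * complex_of_real (H s \<xi>))"
    proof (rule Bochner_Integration.integrable_bound[OF H_int])
      show "(\<lambda>(s, \<xi>). cis (x \<bullet> \<xi>) * complex_of_real (H s \<xi>)) \<in> borel_measurable (lborel \<Otimes>\<^sub>M lborel)"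
        unfolding H_def by measurable
    qed (auto split: prod.split)
    have "?S x = (LINT \<xi>|lborel. LINT s|lborel. cis (x \<bullet> \<xi>) * complex_of_real (H s \<xi>))"
      unfolding ift_def
    proof (rule integral_cong_AE)
      show "AE \<xi> in lborel. cis (x \<bullet> \<xi>) * complex_of_real (symbol \<kappa> \<alpha> 1 \<xi>)
          = (LINT s|lborel. cis (x \<bullet> \<xi>) * complex_of_real (H s \<xi>))"
        using AE_symbol by eventually_elim simp
      show "(\<lambda>\<xi>. LINT s|lborel. cis (x \<bullet> \<xi>) * complex_of_real (H s \<xi>)) \<in> borel_measurable lborel"
        using lborel_pair.integrable_snd[OF cH_int] by auto
    qed measurable
    also have "\<dots> = (LINT s|lborel. LINT \<xi>|lborel. cis (x \<bullet> \<xi>) * complex_of_real (H s \<xi>))"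
      using lborel_pair.Fubini_integral[OF cH_int] by simp
    also have "\<dots> = (LINT s|lborel. of_real (sqrt s ^ ?n * v s) * ?K (sqrt s *\<^sub>R x))"
    proof (rule Bochner_Integration.integral_cong[OF refl])
      fix s :: real
      show "(LINT \<xi>|lborel. cis (x \<bullet> \<xi>) * complex_of_real (H s \<xi>))
          = of_real (sqrt s ^ ?n * v s) * ?K (sqrt s *\<^sub>R x)"
      proof (cases "s > 0")
        case True
        have "(LINT \<xi>|lborel. cis (x \<bullet> \<xi>) * complex_of_real (H s \<xi>))
            = of_real (v s) * ift (\<lambda>\<xi>. complex_of_real (\<beta> (\<xi> /\<^sub>R sqrt s))) x"
          by (simp add: H_def ift_def mult.left_commute)
        also have "\<dots> = of_real (sqrt s ^ ?n * v s) * ?K (sqrt s *\<^sub>R x)"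
          using True by (subst ift_scale) simp_all
        finally show ?thesis .
      qed (simp add: H_def v_def)
    qed
    finally show ?thesis .
  qed
  have meas: "?S \<in> borel_measurable borel"
    by (intro borel_measurable_ift integrable_of_real sym_int)
  show "integrable lborel ?S"
  proof (rule integrableI_bounded)
    have "(\<integral>\<^sup>+x. ennreal (norm (?S x)) \<partial>lborel)
        \<le> (\<integral>\<^sup>+x. \<integral>\<^sup>+s. ennreal (norm (of_real (sqrt s ^ ?n * v s) * ?K (sqrt s *\<^sub>R x))) \<partial>lborel \<partial>lborel)"
      unfolding ift_eq by (intro nn_integral_mono ennreal_norm_integral_le)
    also have "\<dots> = (\<integral>\<^sup>+s. \<integral>\<^sup>+x. ennreal (norm (of_real (sqrt s ^ ?n * v s) * ?K (sqrt s *\<^sub>R x))) \<partial>lborel \<partial>lborel)"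
      by (rule lborel_pair.Fubini') measurable
    \<comment> \<open>The substitution in x removes exactly the factor s^(n/2), so every dilate
      contributes the same L^1 norm, weighted by |v s|.\<close>
    also have "\<dots> = (\<integral>\<^sup>+s. ennreal (norm (v s)) * (\<integral>\<^sup>+x. ennreal (norm (?K x)) \<partial>lborel) \<partial>lborel)"
    proof (rule nn_integral_cong)
      fix s :: real
      show "(\<integral>\<^sup>+x. ennreal (norm (of_real (sqrt s ^ ?n * v s) * ?K (sqrt s *\<^sub>R x))) \<partial>lborel)
          = ennreal (norm (v s)) * (\<integral>\<^sup>+x. ennreal (norm (?K x)) \<partial>lborel)"
      proof (cases "s > 0")
        case True
        have "(\<integral>\<^sup>+x. ennreal (norm (of_real (sqrt s ^ ?n * v s) * ?K (sqrt s *\<^sub>R x))) \<partial>lborel)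
            = (\<integral>\<^sup>+x. ennreal \<bar>v s\<bar> * (ennreal (sqrt s ^ ?n) * ennreal (norm (?K (sqrt s *\<^sub>R x)))) \<partial>lborel)"
          using True by (intro nn_integral_cong) (simp add: norm_mult norm_power abs_mult mult_ac flip: ennreal_mult)
        also have "\<dots> = ennreal \<bar>v s\<bar> * (ennreal (sqrt s ^ ?n) * (\<integral>\<^sup>+x. ennreal (norm (?K (sqrt s *\<^sub>R x))) \<partial>lborel))"
          by (simp add: nn_integral_cmult)
        also have "ennreal (sqrt s ^ ?n) * (\<integral>\<^sup>+x. ennreal (norm (?K (sqrt s *\<^sub>R x))) \<partial>lborel)
            = (\<integral>\<^sup>+x. ennreal (norm (?K x)) \<partial>lborel)"
          using True nn_integral_lborel_affine[of "\<lambda>x. ennreal (norm (?K x))" "sqrt s" 0] by simp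
        finally show ?thesis by simp
      qed (simp add: v_def)
    qed
    also have "\<dots> = (\<integral>\<^sup>+s. ennreal (norm (v s)) \<partial>lborel) * (\<integral>\<^sup>+x. ennreal (norm (?K x)) \<partial>lborel)"
      by (rule nn_integral_multc) measurable
    also have "\<dots> < \<infinity>"
      using v_int K_int by (auto simp: integrable_iff_bounded ennreal_mult_less_top)
    finally show "(\<integral>\<^sup>+x. ennreal (norm (?S x)) \<partial>lborel) < \<infinity>" .
  qed (use meas in simp)
qed

section \<open>Fourier inversion\<close>

text \<open>Unit variance makes this function its own transform up to the factor sqrt(2
  pi)^n.\<close>

definition gauss :: "'a::euclidean_space \<Rightarrow> real" where
  "gauss x = exp (- (norm x)\<^sup>2 / 2)"

lemma borel_measurable_gauss [measurable]: "gauss \<in> borel_measurable borel"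
  unfolding gauss_def by measurable

lemma gauss_bounds: "0 \<le> gauss x" "gauss x \<le> 1"
  by (auto simp: gauss_def)

section \<open>The transform of the Gaussian, coordinate by coordinate\<close>

lemma lborel_integral_prod:
  fixes f :: "'a::euclidean_space \<Rightarrow> real \<Rightarrow> complex"
  assumes f: "\<And>b. b \<in> Basis \<Longrightarrow> integrable lborel (f b)"
  shows "integrable lborel (\<lambda>x::'a. \<Prod>b\<in>Basis. f b (x \<bullet> b))"
    and "(LINT x|lborel. (\<Prod>b\<in>Basis. f b (x \<bullet> b))) = (\<Prod>b\<in>Basis. (LINT y|lborel. f b y))"
proof -
  interpret product_sigma_finite "\<lambda>_::'a. lborel :: real measure" ..
  have [measurable]: "f b \<in> borel_measurable borel" if "b \<in> Basis" for b
    using f[OF that] by auto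
  have meas: "(\<lambda>x::'a. \<Prod>b\<in>Basis. f b (x \<bullet> b)) \<in> borel_measurable borel" by measurable
  show "integrable lborel (\<lambda>x::'a. \<Prod>b\<in>Basis. f b (x \<bullet> b))"
  proof (rule integrableI_bounded)
    have "(\<integral>\<^sup>+x. ennreal (norm (\<Prod>b\<in>Basis. f b (x \<bullet> b))) \<partial>lborel)
        = (\<integral>\<^sup>+x. (\<Prod>b\<in>Basis. ennreal (norm (f b ((x::'a) \<bullet> b)))) \<partial>lborel)"
      by (simp add: prod_norm[symmetric] prod_ennreal)
    also have "\<dots> = (\<Prod>b\<in>Basis. \<integral>\<^sup>+y. ennreal (norm (f b y)) \<partial>lborel)"
      by (rule nn_integral_lborel_prod) auto
    also have "\<dots> < \<infinity>"
      using f by (auto simp: ennreal_prod_eq_top integrable_iff_bounded less_top[symmetric])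
    finally show "(\<integral>\<^sup>+x. ennreal (norm (\<Prod>b\<in>Basis. f b ((x::'a) \<bullet> b))) \<partial>lborel) < \<infinity>" .
  qed (use meas in simp)
  have inner: "(\<Sum>b\<in>Basis. x b *\<^sub>R b) \<bullet> b' = x b'" if "b' \<in> Basis" for x and b' :: 'a
    using that by (simp add: inner_sum_left inner_Basis if_distrib cong: if_cong)
  have "(LINT x|lborel. (\<Prod>b\<in>Basis. f b (x \<bullet> b)))
      = (LINT x|(\<Pi>\<^sub>M b\<in>Basis. lborel). (\<Prod>b\<in>Basis. f b ((\<Sum>b\<in>Basis. x b *\<^sub>R b) \<bullet> b)))"
    unfolding lborel_eq[where 'a = 'a] by (rule integral_distr) (use meas in simp_all)
  also have "\<dots> = (LINT x|(\<Pi>\<^sub>M b\<in>Basis. lborel). (\<Prod>b\<in>Basis. f b (x b)))"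
    by (intro Bochner_Integration.integral_cong refl prod.cong) (simp_all add: inner)
  also have "\<dots> = (\<Prod>b\<in>Basis. (LINT y|lborel. f b y))"
    by (rule product_integral_prod) (use f in auto)
  finally show "(LINT x|lborel. (\<Prod>b\<in>Basis. f b (x \<bullet> b))) = (\<Prod>b\<in>Basis. (LINT y|lborel. f b y))" .
qed

text \<open>This is the characteristic function of the standard normal distribution, freed from the
  density's normalisation.\<close>

lemma gauss_transform_real:
  fixes a :: real
  shows "integrable lborel (\<lambda>y. cis (a * y) * of_real (exp (- y\<^sup>2 / 2)))"
    and "(LINT y|lborel. cis (a * y) * of_real (exp (- y\<^sup>2 / 2))) = of_real (sqrt (2 * pi) * exp (- a\<^sup>2 / 2))"
proof -
  have eq: "cis (a * y) * of_real (exp (- y\<^sup>2 / 2)) = of_real (sqrt (2 * pi)) * (std_normal_density y *\<^sub>R iexp (a * y))" for y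
    by (simp add: std_normal_density_def cis_conv_exp scaleR_conv_of_real flip: of_real_mult)
  have "integrable lborel (\<lambda>y. std_normal_density y *\<^sub>R iexp (a * y))"
    by (rule Bochner_Integration.integrable_bound[OF integrable_normal_density[of 1 0]]) auto
  then show "integrable lborel (\<lambda>y. cis (a * y) * of_real (exp (- y\<^sup>2 / 2)))"
    unfolding eq by (rule integrable_mult_right)
  have "char std_normal_distribution a = (LINT y|lborel. std_normal_density y *\<^sub>R iexp (a * y))"
    unfolding char_def by (rule integral_density) auto
  then have "(LINT y|lborel. std_normal_density y *\<^sub>R iexp (a * y)) = of_real (exp (- a\<^sup>2 / 2))"
    by (simp add: char_std_normal_distribution)
  then show "(LINT y|lborel. cis (a * y) * of_real (exp (- y\<^sup>2 / 2))) = of_real (sqrt (2 * pi) * exp (- a\<^sup>2 / 2))"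
    unfolding eq integral_mult_right_zero by simp
qed

lemma gauss_prod: "gauss x = (\<Prod>b\<in>Basis. exp (- (x \<bullet> b)\<^sup>2 / 2))"
proof -
  have "(norm x)\<^sup>2 = (\<Sum>b\<in>Basis. (x \<bullet> b)\<^sup>2)"
    unfolding power2_norm_eq_inner by (subst euclidean_inner) (simp add: power2_eq_square)
  then show ?thesis by (simp add: gauss_def exp_sum[symmetric] sum_negf sum_divide_distrib)
qed

lemma cis_inner_prod: "cis (\<xi> \<bullet> x) = (\<Prod>b\<in>Basis. cis ((\<xi> \<bullet> b) * (x \<bullet> b)))"
  by (subst euclidean_inner) (simp add: cis_conv_exp sum_distrib_left exp_sum)

lemma integrable_gauss: "integrable lborel (gauss :: 'a::euclidean_space \<Rightarrow> real)"
  and ift_gauss: "ift (\<lambda>x::'a. of_real (gauss x)) \<xi> = of_real (sqrt (2 * pi) ^ DIM('a) * gauss \<xi>)"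
proof -
  have eq: "cis (\<xi> \<bullet> x) * of_real (gauss x)
      = (\<Prod>b\<in>Basis. cis ((\<xi> \<bullet> b) * (x \<bullet> b)) * of_real (exp (- (x \<bullet> b)\<^sup>2 / 2)))" for x \<xi> :: 'a
    unfolding cis_inner_prod[of \<xi> x] gauss_prod by (simp add: prod.distrib)
  note int = gauss_transform_real
  have "integrable lborel (\<lambda>x::'a. cis (0 \<bullet> x) * complex_of_real (gauss x))"
    unfolding eq by (rule lborel_integral_prod(1)) (rule int)
  from integrable_norm[OF this] show "integrable lborel (gauss :: 'a \<Rightarrow> real)"
    by (simp add: gauss_bounds)
  have "ift (\<lambda>x::'a. of_real (gauss x)) \<xi> = (\<Prod>b\<in>Basis. complex_of_real (sqrt (2 * pi) * exp (- (\<xi> \<bullet> b)\<^sup>2 / 2)))"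
    unfolding ift_def eq by (subst lborel_integral_prod(2)[OF int(1)]) (simp only: int(2))
  also have "\<dots> = of_real (sqrt (2 * pi) ^ DIM('a) * gauss \<xi>)"
    by (simp add: gauss_prod prod.distrib del: of_real_mult of_real_power flip: of_real_prod)
  finally show "ift (\<lambda>x::'a. of_real (gauss x)) \<xi> = of_real (sqrt (2 * pi) ^ DIM('a) * gauss \<xi>)" .
qed

text \<open>Fourier inversion by Gaussian summation: the damped integrals
  \<open>\<integral> cis (- (x \<bullet> \<xi>)) * ift m x * gauss (x / c) dx\<close> are Gaussian means of \<open>m\<close> around \<open>\<xi>\<close>.\<close>

lemma ift_inversion:
  fixes m :: "'a::euclidean_space \<Rightarrow> complex"
  assumes m: "integrable lborel m" and k: "integrable lborel (ift m)"
    and cont: "continuous_on UNIV m" and bound: "\<And>\<xi>. cmod (m \<xi>) \<le> C"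
  shows "ift (ift m) (- \<xi>) = of_real ((2 * pi) ^ DIM('a)) * m \<xi>"
proof -
  let ?n = "DIM('a)"
  have [measurable]: "m \<in> borel_measurable borel" "ift m \<in> borel_measurable borel" using m k by auto
  define c where "c j = real (Suc j)" for j
  have c: "c j > 0" for j by (simp add: c_def)
  have c_lim: "(\<lambda>j. 1 / c j) \<longlonglongrightarrow> 0"
    unfolding c_def by (rule LIMSEQ_inverse_real_of_nat[unfolded inverse_eq_divide])
  have gauss_cont: "isCont (gauss :: 'a \<Rightarrow> real) x" for x
    unfolding gauss_def by (intro continuous_intros) auto
  have gauss_dil_int: "integrable lborel (\<lambda>x::'a. gauss (x /\<^sub>R c j))" for j
    using integrable_lborel_affine[OF integrable_gauss, of "inverse (c j)" "0::'a"] c[of j] by simp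
  define A where "A j = (LINT x|lborel. cis (- \<xi> \<bullet> x) * (ift m x * of_real (gauss (x /\<^sub>R c j))))" for j
  have A_lim: "A \<longlonglongrightarrow> ift (ift m) (- \<xi>)"
    unfolding A_def ift_def[of "ift m"]
  proof (rule integral_dominated_convergence[where w = "\<lambda>x. cmod (ift m x)"])
    show "AE x in lborel. (\<lambda>j. cis (- \<xi> \<bullet> x) * (ift m x * of_real (gauss (x /\<^sub>R c j)))) \<longlonglongrightarrow> cis (- \<xi> \<bullet> x) * ift m x"
    proof (rule AE_I2)
      fix x :: 'a
      have "(\<lambda>j. (1 / c j) *\<^sub>R x) \<longlonglongrightarrow> 0 *\<^sub>R x" by (intro tendsto_intros c_lim)
      then have "(\<lambda>j. gauss (x /\<^sub>R c j)) \<longlonglongrightarrow> gauss (0::'a)"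
        by (intro isCont_tendsto_compose[OF gauss_cont]) (simp add: inverse_eq_divide)
      then have "(\<lambda>j. cis (- \<xi> \<bullet> x) * (ift m x * of_real (gauss (x /\<^sub>R c j)))) \<longlonglongrightarrow> cis (- \<xi> \<bullet> x) * (ift m x * of_real (gauss (0::'a)))"
        by (intro tendsto_intros)
      then show "(\<lambda>j. cis (- \<xi> \<bullet> x) * (ift m x * of_real (gauss (x /\<^sub>R c j)))) \<longlonglongrightarrow> cis (- \<xi> \<bullet> x) * ift m x"
        by (simp add: gauss_def)
    qed
    show "AE x in lborel. norm (cis (- \<xi> \<bullet> x) * (ift m x * of_real (gauss (x /\<^sub>R c j)))) \<le> cmod (ift m x)" for j
      by (intro AE_I2) (simp add: norm_mult abs_of_nonneg gauss_bounds mult_left_le)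
  qed (use k in \<open>auto intro: integrable_norm\<close>)
  have A_eq: "A j = of_real (sqrt (2 * pi) ^ ?n) * (LINT z|lborel. m (\<xi> + (1 / c j) *\<^sub>R z) * of_real (gauss z))" for j
  proof -
    let ?P = "\<lambda>x \<eta>. cis (- \<xi> \<bullet> x) * (cis (x \<bullet> \<eta>) * m \<eta> * complex_of_real (gauss (x /\<^sub>R c j)))"
    \<comment> \<open>Without the Gaussian the modulus |m \<eta>| would be constant in x; the
      damping is what makes the double integral absolutely convergent and the exchange
      valid.\<close>
    have P_int: "integrable (lborel \<Otimes>\<^sub>M lborel) (\<lambda>(x, \<eta>). ?P x \<eta>)"
    proof (rule lborel_pair.Fubini_integrable)
      have "(LINT \<eta>|lborel. norm (?P x \<eta>)) = (LINT \<eta>|lborel. cmod (m \<eta>)) * gauss (x /\<^sub>R c j)" for x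
        by (simp add: norm_mult abs_of_nonneg gauss_bounds)
      then show "integrable lborel (\<lambda>x. LINT \<eta>|lborel. norm (case (x, \<eta>) of (x, \<eta>) \<Rightarrow> ?P x \<eta>))"
        using gauss_dil_int[of j] by simp
      show "AE x in lborel. integrable lborel (\<lambda>\<eta>. case (x, \<eta>) of (x, \<eta>) \<Rightarrow> ?P x \<eta>)"
        using integrable_cis_mult[OF m] by auto
    qed measurable
    have "A j = (LINT x|lborel. LINT \<eta>|lborel. ?P x \<eta>)"
      unfolding A_def ift_def[of m] by simp
    also have "\<dots> = (LINT \<eta>|lborel. LINT x|lborel. ?P x \<eta>)"
      using lborel_pair.Fubini_integral[OF P_int] by simp
    also have "\<dots> = (LINT \<eta>|lborel. m \<eta> * ift (\<lambda>x. complex_of_real (gauss (x /\<^sub>R c j))) (\<eta> - \<xi>))"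
    proof (rule Bochner_Integration.integral_cong[OF refl])
      fix \<eta> :: 'a
      have P_eq: "?P x \<eta> = m \<eta> * (cis ((\<eta> - \<xi>) \<bullet> x) * complex_of_real (gauss (x /\<^sub>R c j)))" for x
      proof -
        have cis_eq: "cis (- \<xi> \<bullet> x) * cis (x \<bullet> \<eta>) = cis ((\<eta> - \<xi>) \<bullet> x)"
          by (simp add: cis_mult inner_diff_left inner_commute[of x \<eta>])
        show ?thesis unfolding cis_eq[symmetric] by (simp only: mult_ac)
      qed
      show "(LINT x|lborel. ?P x \<eta>) = m \<eta> * ift (\<lambda>x. complex_of_real (gauss (x /\<^sub>R c j))) (\<eta> - \<xi>)"
        unfolding ift_def P_eq by (rule integral_mult_right_zero)
    qed
    also have "\<dots> = (LINT \<eta>|lborel. of_real (c j ^ ?n * sqrt (2 * pi) ^ ?n) * (m \<eta> * of_real (gauss (c j *\<^sub>R (\<eta> - \<xi>)))))"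
    proof (rule Bochner_Integration.integral_cong[OF refl])
      fix \<eta> :: 'a
      have "ift (\<lambda>x. complex_of_real (gauss (x /\<^sub>R c j))) (\<eta> - \<xi>)
          = of_real (c j ^ ?n) * of_real (sqrt (2 * pi) ^ ?n * gauss (c j *\<^sub>R (\<eta> - \<xi>)))"
        by (subst ift_scale[OF c], subst ift_gauss) (rule refl)
      then show "m \<eta> * ift (\<lambda>x. complex_of_real (gauss (x /\<^sub>R c j))) (\<eta> - \<xi>)
          = of_real (c j ^ ?n * sqrt (2 * pi) ^ ?n) * (m \<eta> * of_real (gauss (c j *\<^sub>R (\<eta> - \<xi>))))"
        by (simp only: of_real_mult mult_ac)
    qed
    also have "\<dots> = of_real (c j ^ ?n * sqrt (2 * pi) ^ ?n) * (LINT \<eta>|lborel. m \<eta> * of_real (gauss (c j *\<^sub>R (\<eta> - \<xi>))))"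
      by simp
    \<comment> \<open>The substitution \<eta> = \<xi> + z/c moves the concentration of the Gaussian
      into the argument of m, and its Jacobian cancels c^n.\<close>
    also have "(LINT \<eta>|lborel. m \<eta> * of_real (gauss (c j *\<^sub>R (\<eta> - \<xi>))))
        = (1 / c j) ^ ?n *\<^sub>R (LINT z|lborel. m (\<xi> + (1 / c j) *\<^sub>R z) * of_real (gauss z))"
      using c[of j] by (subst integral_lborel_affine[where c = "1 / c j" and a = \<xi>]) simp_all
    also have "of_real (c j ^ ?n * sqrt (2 * pi) ^ ?n) * \<dots>
        = of_real (sqrt (2 * pi) ^ ?n) * (LINT z|lborel. m (\<xi> + (1 / c j) *\<^sub>R z) * of_real (gauss z))"
      using c[of j] by (simp add: scaleR_conv_of_real power_divide)
    finally show ?thesis .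
  qed
  have gauss_lim: "(\<lambda>j. of_real (sqrt (2 * pi) ^ ?n) * (LINT z|lborel. m (\<xi> + (1 / c j) *\<^sub>R z) * of_real (gauss z)))
      \<longlonglongrightarrow> of_real (sqrt (2 * pi) ^ ?n) * (LINT z|lborel. m \<xi> * complex_of_real (gauss (z::'a)))"
  proof (rule tendsto_mult_left, rule integral_dominated_convergence[where w = "\<lambda>z. C * gauss z"])
    show "AE z in lborel. (\<lambda>j. m (\<xi> + (1 / c j) *\<^sub>R z) * of_real (gauss z)) \<longlonglongrightarrow> m \<xi> * of_real (gauss z)"
    proof (intro AE_I2 tendsto_mult_right)
      fix z :: 'a
      have "isCont m \<xi>" using cont by (simp add: continuous_on_eq_continuous_at)
      moreover have "(\<lambda>j. \<xi> + (1 / c j) *\<^sub>R z) \<longlonglongrightarrow> \<xi> + 0 *\<^sub>R z" by (intro tendsto_intros c_lim)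
      ultimately show "(\<lambda>j. m (\<xi> + (1 / c j) *\<^sub>R z)) \<longlonglongrightarrow> m \<xi>"
        by (intro isCont_tendsto_compose[of \<xi> m]) simp_all
    qed
    show "AE z in lborel. norm (m (\<xi> + (1 / c j) *\<^sub>R z) * complex_of_real (gauss z)) \<le> C * gauss z" for j
      by (intro AE_I2) (simp add: norm_mult abs_of_nonneg gauss_bounds mult_right_mono bound)
    show "integrable lborel (\<lambda>z::'a. C * gauss z)" by (intro integrable_mult_right integrable_gauss)
  qed measurable
  \<comment> \<open>One factor sqrt(2 pi)^n stems from the transform of the Gaussian, the other is
    its total mass.\<close>
  have gauss_mean: "of_real (sqrt (2 * pi) ^ ?n) * (LINT z|lborel. m \<xi> * complex_of_real (gauss (z::'a)))
      = of_real ((2 * pi) ^ ?n) * m \<xi>"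
  proof -
    have gauss_int: "(LINT z|lborel. complex_of_real (gauss (z::'a))) = of_real (sqrt (2 * pi) ^ ?n)"
      using ift_gauss[of "0::'a"] by (simp add: ift_def gauss_def del: of_real_power)
    have sq: "(2 * pi) ^ ?n = sqrt (2 * pi) ^ ?n * sqrt (2 * pi) ^ ?n"
      unfolding power_mult_distrib[symmetric] by simp
    show ?thesis
      unfolding integral_mult_right_zero gauss_int sq of_real_mult by (simp only: mult_ac)
  qed
  have "A \<longlonglongrightarrow> of_real ((2 * pi) ^ ?n) * m \<xi>"
    using gauss_lim unfolding gauss_mean A_eq[symmetric] .
  with A_lim show ?thesis by (rule LIMSEQ_unique)
qed

section \<open>Scaling and the decay estimate\<close>

definition kern :: "real \<Rightarrow> real \<Rightarrow> real \<Rightarrow> 'a::euclidean_space \<Rightarrow> complex" where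
  "kern \<kappa> \<alpha> t x = ift (\<lambda>\<xi>. of_real (symbol \<kappa> \<alpha> t \<xi>)) x / of_real ((2 * pi) ^ DIM('a))"

lemma symbol_scale:
  assumes \<alpha>: "\<alpha> > 0" and t: "t > 0"
  shows "symbol \<kappa> \<alpha> t \<xi> = t powr (- (\<kappa> / (2 * \<alpha>))) * symbol \<kappa> \<alpha> 1 (t powr (1 / (2 * \<alpha>)) *\<^sub>R \<xi>)"
  using assms by (simp add: symbol_def powr_mult powr_powr powr_minus)

context
  fixes \<kappa> \<alpha> t :: real
  assumes \<kappa>: "\<kappa> \<ge> 0" and \<alpha>: "\<alpha> > 0" and t: "t > 0"
begin

lemma integrable_symbol: "integrable lborel (symbol \<kappa> \<alpha> t :: 'a::euclidean_space \<Rightarrow> real)"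
proof -
  have "integrable lborel (\<lambda>\<xi>::'a. symbol \<kappa> \<alpha> 1 (t powr (1 / (2 * \<alpha>)) *\<^sub>R \<xi>))"
    using integrable_lborel_affine[OF integrable_symbol_one(1)[OF \<kappa> \<alpha>], of "t powr (1 / (2 * \<alpha>))" "0::'a"] t by simp
  then show ?thesis
    unfolding symbol_scale[OF \<alpha> t, abs_def] by (rule integrable_mult_right)
qed

lemma kern_scale:
  fixes x :: "'a::euclidean_space"
  shows "kern \<kappa> \<alpha> t x = of_real (t powr (- (\<kappa> / (2 * \<alpha>))) * t powr (- (real DIM('a) / (2 * \<alpha>))))
    * kern \<kappa> \<alpha> 1 (t powr (- (1 / (2 * \<alpha>))) *\<^sub>R x)"
proof -
  define c where "c = t powr (- (1 / (2 * \<alpha>)))"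
  have c: "c > 0" "inverse c = t powr (1 / (2 * \<alpha>))" using t by (simp_all add: c_def powr_minus)
  have "c ^ DIM('a) = t powr (- (real DIM('a) / (2 * \<alpha>)))"
    using t by (simp add: c_def powr_powr mult.commute flip: powr_realpow)
  moreover have "ift (\<lambda>\<xi>. complex_of_real (symbol \<kappa> \<alpha> t \<xi>)) x
      = of_real (t powr (- (\<kappa> / (2 * \<alpha>)))) * ift (\<lambda>\<xi>. complex_of_real (symbol \<kappa> \<alpha> 1 (\<xi> /\<^sub>R c))) x"
    unfolding ift_def c(2) by (subst symbol_scale[OF \<alpha> t]) (simp only: of_real_mult mult.left_commute[of "cis _"] integral_mult_right_zero)
  ultimately show ?thesis
    unfolding kern_def by (subst (asm) ift_scale[OF c(1)]) (simp add: c_def)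
qed

lemma inv_fourier_symbol:
  fixes m :: "'a::euclidean_space \<Rightarrow> complex"
  assumes "\<And>\<xi>. \<xi> \<noteq> 0 \<Longrightarrow> m \<xi> = of_real (symbol \<kappa> \<alpha> t \<xi>)" "m \<in> borel_measurable borel"
  shows "inv_fourier m = kern \<kappa> \<alpha> t"
proof
  fix x :: 'a
  note assms(2) [measurable]
  have "(LINT \<xi>|lebesgue. cis (x \<bullet> \<xi>) * m \<xi>) = (LINT \<xi>|lborel. cis (x \<bullet> \<xi>) * m \<xi>)"
    by (rule integral_completion) measurable
  also have "\<dots> = ift (\<lambda>\<xi>. of_real (symbol \<kappa> \<alpha> t \<xi>)) x"
    unfolding ift_def
    by (rule integral_cong_AE) (measurable, use AE_lborel_singleton[of "0::'a"] in eventually_elim, simp add: assms(1))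
  finally show "inv_fourier m x = kern \<kappa> \<alpha> t x"
    by (simp add: inv_fourier_def kern_def)
qed

end

lemma integrable_kern_one:
  assumes "\<kappa> \<ge> 0" "\<alpha> > 0"
  shows "integrable lborel (kern \<kappa> \<alpha> 1 :: 'a::euclidean_space \<Rightarrow> complex)"
  unfolding kern_def[abs_def] by (intro integrable_divide_zero integrable_symbol_one(2) assms)

lemma heat_kernel_eq_kern:
  assumes "\<alpha> > 0" "t > 0"
  shows "heat_kernel \<alpha> t = kern 0 \<alpha> t"
  unfolding heat_kernel_def by (rule inv_fourier_symbol) (use assms in \<open>auto simp: symbol_def\<close>)

text \<open>\<open>frac_laplacian\<close> is defined through the Fourier transform of its argument,
  and the heat kernel is itself an inverse transform. Inversion applies because the kernel was shown
  to be integrable.\<close>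

lemma fourier_heat_kernel:
  fixes \<xi> :: "'a::euclidean_space"
  assumes \<alpha>: "\<alpha> > 0" and t: "t > 0"
  shows "fourier (heat_kernel \<alpha> t) \<xi> = of_real (exp (- t * norm \<xi> powr (2 * \<alpha>)))"
proof -
  \<comment> \<open>Inversion is pointwise and asks for continuity, so the exponential is used here
    and not \<open>symbol 0 \<alpha> t\<close>, which jumps to 0 at the origin.\<close>
  define m where "m = (\<lambda>\<xi>::'a. complex_of_real (exp (- t * norm \<xi> powr (2 * \<alpha>))))"
  have [measurable]: "m \<in> borel_measurable borel" unfolding m_def by measurable
  have AE: "AE \<xi> in lborel. complex_of_real (symbol 0 \<alpha> t \<xi>) = m \<xi>"
    using AE_lborel_singleton[of "0::'a"] by eventually_elim (simp add: symbol_def m_def)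
  have "integrable lborel (\<lambda>\<xi>::'a. complex_of_real (symbol 0 \<alpha> t \<xi>))"
    by (intro integrable_of_real integrable_symbol order_refl \<alpha> t)
  then have m_int: "integrable lborel m"
    by (subst (asm) integrable_cong_AE[OF _ _ AE]) auto
  have ift_m: "ift m = ift (\<lambda>\<xi>. complex_of_real (symbol 0 \<alpha> t \<xi>))"
    unfolding ift_def
    by (intro ext integral_cong_AE) (measurable, use AE in eventually_elim, simp)
  have kern_eq: "kern 0 \<alpha> t x = ift m x / of_real ((2 * pi) ^ DIM('a))" for x
    by (simp add: kern_def ift_m)
  have kern_int: "integrable lborel (kern 0 \<alpha> t :: 'a \<Rightarrow> complex)"
    using integrable_lborel_affine[OF integrable_kern_one[OF order_refl \<alpha>], of "t powr (- (1 / (2 * \<alpha>)))" "0::'a"] t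
    unfolding kern_scale[OF order_refl \<alpha> t, abs_def] by simp
  have ift_eq: "ift m = (\<lambda>x. of_real ((2 * pi) ^ DIM('a)) * kern 0 \<alpha> t x)"
    by (auto simp: kern_eq)
  have ift_int: "integrable lborel (ift m)"
    unfolding ift_eq using kern_int by (rule integrable_mult_right)
  have cont: "continuous_on UNIV m"
    unfolding m_def using \<alpha> by (intro continuous_intros continuous_on_powr') auto
  have bound: "cmod (m \<xi>) \<le> 1" for \<xi>
    using t by (simp add: m_def)
  have kern_meas: "kern 0 \<alpha> t \<in> borel_measurable (borel :: 'a measure)" using kern_int by auto
  have "fourier (heat_kernel \<alpha> t) \<xi> = (LINT x|lborel. cis (- (x \<bullet> \<xi>)) * kern 0 \<alpha> t x)"
    unfolding fourier_def heat_kernel_eq_kern[OF \<alpha> t] using kern_meas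
    by (intro integral_completion) measurable
  also have "\<dots> = ift (ift m) (- \<xi>) / of_real ((2 * pi) ^ DIM('a))"
    unfolding kern_eq ift_def[of "ift m"] by (simp add: inner_commute del: of_real_power)
  also have "\<dots> = m \<xi>"
    unfolding ift_inversion[OF m_int ift_int cont bound] by simp
  finally show ?thesis by (simp add: m_def)
qed

lemma frac_laplacian_heat_kernel:
  assumes "\<kappa> > 0" "\<alpha> > 0" "t > 0"
  shows "frac_laplacian (\<kappa> / 2) (heat_kernel \<alpha> t) = kern \<kappa> \<alpha> t"
  unfolding frac_laplacian_def fourier_multiplier_def fourier_heat_kernel[OF assms(2,3)]
  by (rule inv_fourier_symbol) (use assms in \<open>auto simp: symbol_def\<close>)

lemma conv_kern_estimate:
  fixes p r :: "'a::euclidean_space \<Rightarrow> ennreal"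
  assumes \<kappa>: "\<kappa> \<ge> 0" and \<alpha>: "\<alpha> > 0" and p: "p \<in> exponents" and r: "r \<in> exponents"
    and \<nu>: "1 \<le> \<nu>" "\<nu> \<le> essinf lebesgue p"
  obtains C where "C > 0" "\<And>t \<phi>. t > 0 \<Longrightarrow> \<phi> \<in> Lvar r \<Longrightarrow> \<phi> \<in> Lconst \<nu> \<Longrightarrow>
    conv (kern \<kappa> \<alpha> t) \<phi> \<in> Lvar p \<and>
    Lvar_norm p (conv (kern \<kappa> \<alpha> t) \<phi>)
      \<le> C * t powr (- (\<kappa> / (2 * \<alpha>)) - real DIM('a) * decay_omega p r \<nu> t / (2 * \<alpha>))
          * max (Lvar_norm r \<phi>) (Lconst_norm \<nu> \<phi>)"
proof -
  let ?k = "kern \<kappa> \<alpha> 1 :: 'a \<Rightarrow> complex"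
  have k1_int: "integrable lborel ?k" by (rule integrable_kern_one[OF \<kappa> \<alpha>])
  have [measurable]: "?k \<in> borel_measurable borel" using k1_int by auto
  define S where "S = (LINT \<xi>::'a|lborel. cmod (complex_of_real (symbol \<kappa> \<alpha> 1 \<xi>))) / (2 * pi) ^ DIM('a)"
  have "norm (complex_of_real ((2 * pi) ^ DIM('a))) = (2 * pi) ^ DIM('a)"
    by (simp add: norm_power norm_mult)
  then have S: "cmod (?k x) \<le> S" for x
    unfolding kern_def S_def norm_divide by (simp only:) (rule divide_right_mono[OF cmod_ift_le], simp)
  define I where "I = (LINT x|lborel. cmod (?k x))"
  have I: "(\<integral>\<^sup>+x. ennreal (cmod (?k x)) \<partial>lborel) = ennreal I"
    unfolding I_def by (rule nn_integral_eq_integral) (use k1_int in \<open>auto intro: integrable_norm\<close>)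
  \<comment> \<open>D dominates both the supremum and the L^1 norm of the kernel at t = 1; the
    summand 1 keeps it positive.\<close>
  define D where "D = 1 + S + I"
  have "S \<ge> 0" using order_trans[OF _ S[of 0]] by simp
  moreover have "I \<ge> 0" by (simp add: I_def)
  ultimately have D: "D > 0" "S \<le> D" "I \<le> D" by (auto simp: D_def)
  have "conv (kern \<kappa> \<alpha> t) \<phi> \<in> Lvar p \<and>
    Lvar_norm p (conv (kern \<kappa> \<alpha> t) \<phi>)
      \<le> 2 * D * t powr (- (\<kappa> / (2 * \<alpha>)) - real DIM('a) * decay_omega p r \<nu> t / (2 * \<alpha>))
          * max (Lvar_norm r \<phi>) (Lconst_norm \<nu> \<phi>)"
    if t: "t > 0" and \<phi>: "\<phi> \<in> Lvar r" "\<phi> \<in> Lconst \<nu>" for t \<phi>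
  proof -
    define c N T where "c = t powr (- (1 / (2 * \<alpha>)))" and "N = t powr (- (real DIM('a) / (2 * \<alpha>)))"
      and "T = t powr (- (\<kappa> / (2 * \<alpha>)))"
    have pos: "c > 0" "N > 0" "T > 0" using t by (simp_all add: c_def N_def T_def)
    have cN: "c ^ DIM('a) = N"
      using t by (simp add: c_def N_def powr_powr mult.commute flip: powr_realpow)
    have kern_eq: "kern \<kappa> \<alpha> t x = of_real (T * N) * ?k (c *\<^sub>R x)" for x :: 'a
      unfolding c_def N_def T_def by (rule kern_scale[OF \<kappa> \<alpha> t])
    have k_meas: "kern \<kappa> \<alpha> t \<in> borel_measurable (borel :: 'a measure)"
      unfolding kern_eq[abs_def] by measurable
    have k_bound: "cmod (kern \<kappa> \<alpha> t x) \<le> (D * T) * N" for x :: 'a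
    proof -
      have "cmod (kern \<kappa> \<alpha> t x) = T * N * cmod (?k (c *\<^sub>R x))"
        using pos by (simp add: kern_eq norm_mult)
      also have "\<dots> \<le> T * N * D" using S[of "c *\<^sub>R x"] D pos by (intro mult_left_mono) auto
      finally show ?thesis by (simp add: mult_ac)
    qed
    \<comment> \<open>The substitution by c absorbs N = c^n: the L^1 norm scales with T alone,
      whereas the supremum retains the factor N.\<close>
    have k_int: "(\<integral>\<^sup>+x. ennreal (cmod (kern \<kappa> \<alpha> t (x::'a))) \<partial>lborel) \<le> ennreal (D * T)"
    proof -
      have "(\<integral>\<^sup>+x. ennreal (cmod (kern \<kappa> \<alpha> t (x::'a))) \<partial>lborel)
          = (\<integral>\<^sup>+x. ennreal T * (ennreal N * ennreal (cmod (?k (c *\<^sub>R x)))) \<partial>lborel)"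
        using pos by (intro nn_integral_cong) (simp add: kern_eq norm_mult mult_ac flip: ennreal_mult)
      also have "\<dots> = ennreal T * (ennreal N * (\<integral>\<^sup>+x. ennreal (cmod (?k (c *\<^sub>R x))) \<partial>lborel))"
        by (simp add: nn_integral_cmult)
      also have "ennreal N * (\<integral>\<^sup>+x. ennreal (cmod (?k (c *\<^sub>R x))) \<partial>lborel) = ennreal I"
        using nn_integral_lborel_affine[of "\<lambda>x. ennreal (cmod (?k x))" c 0] pos by (simp add: cN I)
      also have "ennreal T * ennreal I \<le> ennreal (D * T)"
        using D pos by (subst ennreal_mult'[symmetric]) (auto intro!: ennreal_leI simp: mult.commute mult_right_mono)
      finally show ?thesis .
    qed
    have N_ge: "1 \<le> N" if "t \<le> 1"
      using t that \<alpha> powr_mono'[of "- (real DIM('a) / (2 * \<alpha>))" 0 t] by (simp add: N_def)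
    have N_le: "N \<le> 1" if "1 < t"
      using that \<alpha> powr_mono[of "- (real DIM('a) / (2 * \<alpha>))" 0 t] by (simp add: N_def)
    have "D * T > 0" using D pos by simp
    note est = conv_Lvar_decay[OF k_meas this pos(2) N_ge N_le k_bound k_int p r \<nu> \<phi>]
    have eq: "2 * (D * T) * N powr decay_omega p r \<nu> t
        = 2 * D * t powr (- (\<kappa> / (2 * \<alpha>)) - real DIM('a) * decay_omega p r \<nu> t / (2 * \<alpha>))"
      using t by (simp add: T_def N_def powr_powr flip: powr_add)
    show ?thesis by (rule est[where t = t, unfolded eq])
  qed
  then show thesis using that[of "2 * D"] D by simp
qed

theorem theorem4p4:
  fixes \<alpha> \<kappa> :: real
    and p r :: "real ^ 'n \<Rightarrow> ennreal"
    and \<nu> :: ennreal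
  assumes "\<alpha> > 0" and "\<kappa> > 0"
    and "p \<in> exponents" and "r \<in> exponents"
    and "1 \<le> \<nu>" and "\<nu> \<le> essinf lebesgue p"
  shows "\<exists>C>0. \<forall>t>0. \<forall>\<phi> \<in> Lvar r \<inter> Lconst \<nu>.
    (conv (heat_kernel \<alpha> t) \<phi> \<in> Lvar p \<and>
     Lvar_norm p (conv (heat_kernel \<alpha> t) \<phi>)
       \<le> C * t powr (- (real CARD('n) * decay_omega p r \<nu> t / (2 * \<alpha>)))
           * max (Lvar_norm r \<phi>) (Lconst_norm \<nu> \<phi>)) \<and>
    (conv (frac_laplacian (\<kappa> / 2) (heat_kernel \<alpha> t)) \<phi> \<in> Lvar p \<and>
     Lvar_norm p (conv (frac_laplacian (\<kappa> / 2) (heat_kernel \<alpha> t)) \<phi>)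
       \<le> C * t powr (- (\<kappa> / (2 * \<alpha>)) - real CARD('n) * decay_omega p r \<nu> t / (2 * \<alpha>))
           * max (Lvar_norm r \<phi>) (Lconst_norm \<nu> \<phi>))"
proof -
  obtain C0 where C0: "C0 > 0" "\<And>t \<phi>. t > 0 \<Longrightarrow> \<phi> \<in> Lvar r \<Longrightarrow> \<phi> \<in> Lconst \<nu> \<Longrightarrow>
    conv (kern 0 \<alpha> t) \<phi> \<in> Lvar p \<and> Lvar_norm p (conv (kern 0 \<alpha> t) \<phi>)
      \<le> C0 * t powr (- (0 / (2 * \<alpha>)) - real DIM(real ^ 'n) * decay_omega p r \<nu> t / (2 * \<alpha>))
          * max (Lvar_norm r \<phi>) (Lconst_norm \<nu> \<phi>)"
    using conv_kern_estimate[OF order_refl assms(1,3-6)] by blast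
  obtain C1 where C1: "C1 > 0" "\<And>t \<phi>. t > 0 \<Longrightarrow> \<phi> \<in> Lvar r \<Longrightarrow> \<phi> \<in> Lconst \<nu> \<Longrightarrow>
    conv (kern \<kappa> \<alpha> t) \<phi> \<in> Lvar p \<and> Lvar_norm p (conv (kern \<kappa> \<alpha> t) \<phi>)
      \<le> C1 * t powr (- (\<kappa> / (2 * \<alpha>)) - real DIM(real ^ 'n) * decay_omega p r \<nu> t / (2 * \<alpha>))
          * max (Lvar_norm r \<phi>) (Lconst_norm \<nu> \<phi>)"
    using conv_kern_estimate[OF less_imp_le[OF assms(2)] assms(1,3-6)] by blast
  \<comment> \<open>Enlarging the constant requires a nonnegative norm factor; this uses membership
    in \<open>Lvar r\<close>, where the real infimum is taken over a nonempty set.\<close>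
  have bound: "X \<le> max C0 C1 * s * max (Lvar_norm r \<phi>) y"
    if "X \<le> C' * s * max (Lvar_norm r \<phi>) y" "C' \<le> max C0 C1" "0 \<le> s" "\<phi> \<in> Lvar r" for X C' s y \<phi>
  proof -
    have "0 \<le> max (Lvar_norm r \<phi>) y"
      using Lvar_norm_nonneg[OF that(4) assms(4)] by simp
    with that show ?thesis
      by (intro order_trans[OF that(1)] mult_right_mono) auto
  qed
  show ?thesis
  proof (intro exI[of _ "max C0 C1"] conjI allI impI ballI)
    fix t :: real and \<phi> assume t: "t > 0" and "\<phi> \<in> Lvar r \<inter> Lconst \<nu>"
    then have \<phi>: "\<phi> \<in> Lvar r" "\<phi> \<in> Lconst \<nu>" by auto
    note heat_eq = heat_kernel_eq_kern[OF assms(1) t]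
    note frac_eq = frac_laplacian_heat_kernel[OF assms(2,1) t]
    show "conv (frac_laplacian (\<kappa> / 2) (heat_kernel \<alpha> t)) \<phi> \<in> Lvar p"
      using C1(2)[OF t \<phi>] unfolding frac_eq by simp
    show "conv (heat_kernel \<alpha> t) \<phi> \<in> Lvar p"
      using C0(2)[OF t \<phi>] unfolding heat_eq by simp
    show "Lvar_norm p (conv (heat_kernel \<alpha> t) \<phi>)
       \<le> max C0 C1 * t powr (- (real CARD('n) * decay_omega p r \<nu> t / (2 * \<alpha>)))
           * max (Lvar_norm r \<phi>) (Lconst_norm \<nu> \<phi>)"
      using C0(2)[OF t \<phi>] \<phi> unfolding heat_eq by (intro bound[of _ C0]) simp_all
    show "Lvar_norm p (conv (frac_laplacian (\<kappa> / 2) (heat_kernel \<alpha> t)) \<phi>)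
       \<le> max C0 C1 * t powr (- (\<kappa> / (2 * \<alpha>)) - real CARD('n) * decay_omega p r \<nu> t / (2 * \<alpha>))
           * max (Lvar_norm r \<phi>) (Lconst_norm \<nu> \<phi>)"
      using C1(2)[OF t \<phi>] \<phi> unfolding frac_eq by (intro bound[of _ C1]) simp_all
  qed (use C0 in simp)
qed

end
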